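(* Let $\varepsilon\in\{-1,1\}$, let $k\ge1$ be an integer, let $B=\{b_1,\dots,b_k\}$ be a set of $k$ (distinct) positive integers and let $\mathbf{S}=(S_1,\dots,S_k)$ be a $k$-tuple of finite, nonempty subsets of $[0,+\infty)$. Let $\mathcal{K}_{\max}$, $T(K)$, $\Lambda(\mathcal{K})$ be determined by $B$ and $\mathbf{S}$ as in the context, and let $$\alpha=\sum_{i}|S_i|,\quad b=\max_i b_i,\quad e=\sum_{K\in\mathcal{K}_{\max}}|T(K)|(|K|-1),$$ $$c_\varepsilon(p)=\big|\{A\in AP(B,\mathbf{S})\cap2^{[1,p-1]}:\chi_p(a)=\varepsilon\text{ for all }a\in A\}\big|.$$ (i) If $\Lambda(\mathcal{K})$ is empty then $c_\varepsilon(p)\sim(b\cdot2^{\alpha})^{-1}p$ as $p\to+\infty$. (ii) If $\Lambda(\mathcal{K})$ is not empty then: (a) $e$ is positive; (b) if $\prod_{i\in I}b_i$ is a square for all $I\in\Lambda(\mathcal{K})$, then $c_\varepsilon(p)\sim(b\cdot2^{\alpha-e})^{-1}p$ as $p\to+\infty$; (c) if there exists $I\in\Lambda(\mathcal{K})$ such that $\prod_{i\in I}b_i$ is not a square, then ($\alpha$) the set $\Pi_+$ of primes with positive $(B,\mathbf{S})$-signature and the set $\Pi_-$ of primes with non-positive $(B,\mathbf{S})$-signature are both infinite, ($\beta$) $c_\varepsilon(p)=0$ for all $p\in\Pi_-$, and ($\gamma$) as $p\to+\infty$ inside $\Pi_+$, $c_\varepsilon(p)\sim(b\cdot2^{\a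lpha-e})^{-1}p$.
   Context: Notation: $[m,n]$ is the set of integers $x$ with $m\le x\le n$, and $[m,+\infty)$ the set of integers $\ge m$; $2^A$ is the set of all subsets of $A$; $\mathcal{E}(A)$ is the set of all nonempty subsets of $A$ of even cardinality. $p$ always denotes an odd prime and $\chi_p$ the Legendre symbol modulo $p$. For sequences indexed by an infinite set $\Pi$ of primes, $a(p)\sim b(p)$ as $p\to+\infty$ inside $\Pi$ means $a(p)/b(p)\to1$ as $p\to+\infty$, $p\in\Pi$; if no set is mentioned, $\Pi$ is the set of all odd primes. $AP(B,\mathbf{S})=\big\{\bigcup_{i=1}^{k}(b_in+S_i):n\in[1,+\infty)\big\}$, where $b_in+S_i=\{b_in+x:x\in S_i\}$. For $b\ge1$ and $S\subseteq[0,+\infty)$, $b^{-1}S=\{z/b:z\in S\}\subseteq\mathbb{Q}$. Let $$\mathcal{K}=\Big\{\emptyset\ne K\subseteq[1,k]:\bigcap_{i\in K}b_i^{-1}S_i\ne\emptyset\Big\},$$ and for $K\in\mathcal{K}$ let $$S(K)=\bigcap_{i\in K}b_i^{-1}S_i,\qquad T(K)=S(K)\cap\bigcap_{i\in[1,k]\setminus K}(\mathbb{Q}\setminus b_i^{-1}S_i).$$ Let $\mathcal{K}_{\max}=\{K\in\mathcal{K}:T(K)\ne\emptyset\}$ and $\Lambda(\mathcal{K})=\bigcup_{K\in\mathcal{K}_{\max}}\mathcal{E}(K)$. Suppose $\Lambda(\mathcal{K})\neq\emptyset$. An odd prime $p$ is allowable if $p$ divides no element of $B$. The $(B,\mathbf{S})$-signature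 of an allowable prime $p$ is the multi-set $\{\chi_p(\prod_{i\in I}b_i):I\in\Lambda(\mathcal{K})\}$ of $\pm1$'s; it is positive if all its elements are $1$, and non-positive otherwise. $\Pi_+$ (respectively $\Pi_-$) is the set of allowable primes whose $(B,\mathbf{S})$-signature is positive (respectively non-positive). *)

theory Defs
  imports
    "HOL-Number_Theory.Number_Theory"
    "HOL-Computational_Algebra.Nth_Powers"
    "HOL-Library.Landau_Symbols"
begin

(* Throughout, b enumerates B = {b 1, ..., b k} and S the k-tuple (S 1, ..., S k);
   the values of b and S outside {1..k} are never used. *)

definition even_subsets :: "'a set \<Rightarrow> 'a set set" where
  "even_subsets A = {I. I \<subseteq> A \<and> I \<noteq> {} \<and> finite I \<and> even (card I)}"

definition AP :: "nat \<Rightarrow> (nat \<Rightarrow> nat) \<Rightarrow> (nat \<Rightarrow> nat set) \<Rightarrow> nat set set" where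
  "AP k b S = {(\<Union>i\<in>{1..k}. (\<lambda>x. b i * n + x) ` S i) | n. n \<ge> 1}"

definition scaled :: "nat \<Rightarrow> nat set \<Rightarrow> rat set" where
  "scaled c X = (\<lambda>z. of_nat z / of_nat c) ` X"

definition S_of :: "(nat \<Rightarrow> nat) \<Rightarrow> (nat \<Rightarrow> nat set) \<Rightarrow> nat set \<Rightarrow> rat set" where
  "S_of b S K = (\<Inter>i\<in>K. scaled (b i) (S i))"

definition K_family :: "nat \<Rightarrow> (nat \<Rightarrow> nat) \<Rightarrow> (nat \<Rightarrow> nat set) \<Rightarrow> nat set set" where
  "K_family k b S = {K. K \<noteq> {} \<and> K \<subseteq> {1..k} \<and> S_of b S K \<noteq> {}}"

definition T_of :: "nat \<Rightarrow> (nat \<Rightarrow> nat) \<Rightarrow> (nat \<Rightarrow> nat set) \<Rightarrow> nat set \<Rightarrow> rat set" where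
  "T_of k b S K = S_of b S K \<inter> (\<Inter>i\<in>{1..k} - K. UNIV - scaled (b i) (S i))"

definition K_max :: "nat \<Rightarrow> (nat \<Rightarrow> nat) \<Rightarrow> (nat \<Rightarrow> nat set) \<Rightarrow> nat set set" where
  "K_max k b S = {K \<in> K_family k b S. T_of k b S K \<noteq> {}}"

definition Lambda :: "nat \<Rightarrow> (nat \<Rightarrow> nat) \<Rightarrow> (nat \<Rightarrow> nat set) \<Rightarrow> nat set set" where
  "Lambda k b S = (\<Union>K\<in>K_max k b S. even_subsets K)"

definition odd_primes :: "nat set" where
  "odd_primes = {p. prime p \<and> odd p}"

definition allowable :: "nat \<Rightarrow> (nat \<Rightarrow> nat) \<Rightarrow> nat \<Rightarrow> bool" where
  "allowable k b p \<longleftrightarrow> p \<in> odd_primes \<and> (\<forall>i\<in>{1..k}. \<not> p dvd b i)"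

(* mset_set of an infinite set would be empty; here Lambda k b S is a set of subsets of
   {1..k}, hence finite. *)
definition signature :: "nat \<Rightarrow> (nat \<Rightarrow> nat) \<Rightarrow> (nat \<Rightarrow> nat set) \<Rightarrow> nat \<Rightarrow> int multiset" where
  "signature k b S p =
     image_mset (\<lambda>I. Legendre (int (\<Prod>i\<in>I. b i)) (int p)) (mset_set (Lambda k b S))"

definition positive_signature :: "nat \<Rightarrow> (nat \<Rightarrow> nat) \<Rightarrow> (nat \<Rightarrow> nat set) \<Rightarrow> nat \<Rightarrow> bool" where
  "positive_signature k b S p \<longleftrightarrow> (\<forall>x\<in>#signature k b S p. x = 1)"

definition Pi_plus :: "nat \<Rightarrow> (nat \<Rightarrow> nat) \<Rightarrow> (nat \<Rightarrow> nat set) \<Rightarrow> nat set" where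
  "Pi_plus k b S = {p. allowable k b p \<and> positive_signature k b S p}"

definition Pi_minus :: "nat \<Rightarrow> (nat \<Rightarrow> nat) \<Rightarrow> (nat \<Rightarrow> nat set) \<Rightarrow> nat set" where
  "Pi_minus k b S = {p. allowable k b p \<and> \<not> positive_signature k b S p}"

definition alpha :: "nat \<Rightarrow> (nat \<Rightarrow> nat set) \<Rightarrow> nat" where
  "alpha k S = (\<Sum>i\<in>{1..k}. card (S i))"

definition bmax :: "nat \<Rightarrow> (nat \<Rightarrow> nat) \<Rightarrow> nat" where
  "bmax k b = Max (b ` {1..k})"

definition e_exp :: "nat \<Rightarrow> (nat \<Rightarrow> nat) \<Rightarrow> (nat \<Rightarrow> nat set) \<Rightarrow> int" where
  "e_exp k b S = (\<Sum>K\<in>K_max k b S. int (card (T_of k b S K)) * (int (card K) - 1))"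

definition c_count :: "int \<Rightarrow> nat \<Rightarrow> (nat \<Rightarrow> nat) \<Rightarrow> (nat \<Rightarrow> nat set) \<Rightarrow> nat \<Rightarrow> nat" where
  "c_count \<epsilon> k b S p =
     card {A \<in> AP k b S \<inter> Pow {1..p - 1}. \<forall>a\<in>A. Legendre (int a) (int p) = \<epsilon>}"

(* p tends to infinity inside P.  The clause in asymp_equiv that treats 0/0 as 1 plays no
   role when g is nonzero at all positive p, so this is f p / g p \<longlonglongrightarrow> 1 along P. *)
definition sim_inside :: "nat set \<Rightarrow> (nat \<Rightarrow> real) \<Rightarrow> (nat \<Rightarrow> real) \<Rightarrow> bool" where
  "sim_inside P f g \<longleftrightarrow> f \<sim>[inf at_top (principal P)] g"

end

theory Submission
  imports Defs "HOL-Computational_Algebra.Polynomial_Factorial"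
begin

text \<open>
  Let \<open>Q\<close> be the union of the sets \<open>S\<^sub>i / b\<^sub>i\<close>. For \<open>q = z / b\<^sub>i\<close> one has \<open>b\<^sub>i n + z = b\<^sub>i (n + q)\<close>,
  so the conditions on the members of a progression that belong to the same point \<open>q\<close> are
  compatible only if the \<open>b\<^sub>i\<close> involved have the same quadratic character, which is what a positive
  signature says, and then they collapse to a single condition. This leaves \<open>|Q| = \<alpha> - e\<close>
  conditions on \<open>n \<le> p / b\<close>, each fulfilled half of the time and asymptotically independent
  because incomplete sums of \<open>\<chi>\<^sub>p\<close> over products of distinct linear forms are \<open>o(p)\<close>.

  For these sums Weil's bound is not needed. Stepanov's auxiliary polynomial, with a vanishing order that
  stays fixed as \<open>p\<close> grows, gives \<open>o(p)\<close> for complete sums over polynomials of odd degree; inverting one of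
  the forms reduces an even number of forms to that case; and van der Corput's shifts pass
  to incomplete sums while only using complete sums over an even number of forms.

  All \<open>b\<^sub>i\<close> are residues modulo a prime that is 1 modulo \<open>8 b\<^sub>1 \<dots> b\<^sub>k\<close>, which makes \<open>\<Pi>\<^sub>+\<close> infinite.
  For \<open>\<Pi>\<^sub>-\<close> one applies reciprocity to a prime divisor of a suitable \<open>x\<^sup>2 + 1\<close>, all of whose odd prime divisors
  are 1 modulo 4.
\<close>

section \<open>Zeros of integer polynomials modulo a prime\<close>

text \<open>Parity is the obstacle. For an even degree \<open>m\<close> the number
  \<open>m g\<close> is congruent to \<open>- m / 2\<close> modulo \<open>p\<close>, so the two
  blocks of degrees in the auxiliary polynomial overlap; no such argument can cover all even
  degrees, as \<open>f\<close> may be a square. Van der Corput's correlations pair a product of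
  forms with a shift of itself and thus always involve an even number of forms; inverting one of
  them leaves an odd degree. Correlations may contain proportional forms, which does no harm as long
  as the inverted form is proportional to no other one. A fixed vanishing order \<open>2 s\<close>
  leaves an error of order \<open>p / s\<close>, which is enough for an asymptotic formula. For the
  nonresidues the usual tool is Dirichlet's theorem on primes in progressions. Here a number
  \<open>N\<close> with the wanted character suffices: the character is multiplicative, so it
  differs from 1 at some prime factor of \<open>N\<close>. Reciprocity without signs wants all these
  factors to be 1 modulo 4, hence the shape \<open>x^2 + 1\<close>.\<close>

lemma const_dvd_poly: "[:c:] dvd f \<Longrightarrow> c dvd poly f x" for c :: "'a::comm_ring_1"
  by (auto elim!: dvdE)

lemma const_dvd_pderiv: "[:c:] dvd f \<Longrightarrow> [:c:] dvd pderiv f" for c :: int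
  by (auto simp: const_poly_dvd_iff coeff_pderiv)

lemma higher_pderiv_linear_mult:
  fixes Q :: "int poly"
  shows "(pderiv ^^ k) ([:-a, 1:] * Q) =
    [:-a, 1:] * (pderiv ^^ k) Q + of_nat k * (pderiv ^^ (k - 1)) Q"
proof (induction k)
  case (Suc k)
  define L where "L = [:-a, 1:]"
  have L: "pderiv L = 1" by (simp add: L_def pderiv_pCons)
  have "of_nat k * pderiv ((pderiv ^^ (k - 1)) Q) = of_nat k * (pderiv ^^ k) Q"
    by (cases k) auto
  moreover have "pderiv (of_nat k * (pderiv ^^ (k - 1)) Q) = of_nat k * pderiv ((pderiv ^^ (k - 1)) Q)"
    by (simp add: pderiv_mult)
  moreover have "(pderiv ^^ k) (L * Q) = L * (pderiv ^^ k) Q + of_nat k * (pderiv ^^ (k - 1)) Q"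
    using Suc.IH by (simp only: L_def)
  ultimately have "(pderiv ^^ Suc k) (L * Q) =
      L * (pderiv ^^ Suc k) Q + of_nat (Suc k) * (pderiv ^^ (Suc k - 1)) Q"
    by (simp add: pderiv_add pderiv_mult L algebra_simps)
  thus ?case by (simp only: L_def)
qed simp

text \<open>Induction on the total multiplicity, splitting off one linear factor at a time. Integer
  polynomials stand in for polynomials over the field with \<open>p\<close> elements,
  \<open>[:int p:] dvd R\<close> meaning that \<open>R\<close> is zero there.\<close>

lemma sum_root_multiplicities_mod_prime_le:
  fixes R :: "int poly" and mu :: "int \<Rightarrow> nat"
  assumes "prime p" "finite A"
    and "\<And>a a'. a \<in> A \<Longrightarrow> a' \<in> A \<Longrightarrow> int p dvd a - a' \<Longrightarrow> a = a'"
    and "\<And>a. a \<in> A \<Longrightarrow> mu a \<le> p"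
    and "\<And>a k. a \<in> A \<Longrightarrow> k < mu a \<Longrightarrow> int p dvd poly ((pderiv ^^ k) R) a"
    and "\<not> [:int p:] dvd R"
  shows "sum mu A \<le> degree R"
  using assms(4-)
proof (induction "sum mu A" arbitrary: mu R)
  case (Suc n)
  have pp: "prime (int p)" using assms(1) by simp
  obtain a where a: "a \<in> A" "mu a > 0"
    using Suc.hyps(2) assms(2) by (metis Zero_not_Suc gr0I sum.neutral)
  define Q where "Q = synthetic_div R a"
  have R: "R = [:-a, 1:] * Q + [:poly R a:]"
    unfolding Q_def by (rule synthetic_div_correct'[symmetric])
  have "int p dvd poly R a" using Suc.prems(2)[OF a(1) a(2)] by simp
  hence "[:int p:] dvd [:poly R a:]" by simp
  hence Q0: "\<not> [:int p:] dvd Q"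
    using Suc.prems(3) R by (metis dvd_add dvd_mult)
  hence deg: "degree R = Suc (degree Q)"
  proof -
    have "Q \<noteq> 0" using Q0 by auto
    hence "degree R \<noteq> 0" unfolding Q_def using synthetic_div_eq_0_iff by blast
    thus ?thesis unfolding Q_def by (simp add: degree_synthetic_div)
  qed
  have der: "int p dvd poly ((pderiv ^^ k) R) x \<longleftrightarrow>
      int p dvd (x - a) * poly ((pderiv ^^ k) Q) x + int k * poly ((pderiv ^^ (k - 1)) Q) x" for k x
  proof -
    have c: "int p dvd poly ((pderiv ^^ k) [:poly R a:]) x"
    proof -
      have "[:int p:] dvd (pderiv ^^ k) [:poly R a:]"
        by (induction k) (use \<open>[:int p:] dvd [:poly R a:]\<close> const_dvd_pderiv in auto)
      thus ?thesis by (rule const_dvd_poly)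
    qed
    have "(pderiv ^^ k) (f + g) = (pderiv ^^ k) f + (pderiv ^^ k) g" for f g :: "int poly"
      by (induction k) (auto simp: pderiv_add)
    hence "poly ((pderiv ^^ k) R) x = poly ((pderiv ^^ k) ([:-a, 1:] * Q)) x
        + poly ((pderiv ^^ k) [:poly R a:]) x"
      by (subst R) simp
    moreover have "poly ((pderiv ^^ k) ([:-a, 1:] * Q)) x =
        (x - a) * poly ((pderiv ^^ k) Q) x + int k * poly ((pderiv ^^ (k - 1)) Q) x"
      by (subst higher_pderiv_linear_mult) (simp add: algebra_simps)
    ultimately show ?thesis using c by (simp add: dvd_add_left_iff)
  qed
  define mu' where "mu' = mu(a := mu a - 1)"
  have s: "sum mu A = Suc (sum mu' A)"
    using a assms(2) by (simp add: mu'_def sum.remove[of A a])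
  have "sum mu' A \<le> degree Q"
  proof (rule Suc.hyps(1))
    show "n = sum mu' A" using s Suc.hyps(2) by simp
    show "mu' x \<le> p" if "x \<in> A" for x
      using Suc.prems(1)[OF that] Suc.prems(1)[OF a(1)] by (auto simp: mu'_def)
    show "int p dvd poly ((pderiv ^^ k) Q) x" if x: "x \<in> A" and k: "k < mu' x" for x k
    proof (cases "x = a")
      case True
      \<comment> \<open>At the root \<open>a\<close> the factor \<open>x - a\<close> kills the first
        term and leaves \<open>k + 1\<close> times the k-th derivative of \<open>Q\<close>; as
        \<open>k + 1 < mu a \<le> p\<close>, the number \<open>k + 1\<close> is invertible modulo
        \<open>p\<close>.\<close>
      have "Suc k < mu a" using k True by (simp add: mu'_def)
      hence "int p dvd poly ((pderiv ^^ Suc k) R) a" by (rule Suc.prems(2)[OF a(1)])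
      hence "int p dvd int (Suc k) * poly ((pderiv ^^ k) Q) a"
        using der[of "Suc k" a] by simp
      moreover have "\<not> int p dvd int (Suc k)"
        using \<open>Suc k < mu a\<close> Suc.prems(1)[OF a(1)] by (auto dest: zdvd_imp_le)
      ultimately show ?thesis using pp True by (simp add: prime_dvd_mult_iff)
    next
      case False
      \<comment> \<open>Away from \<open>a\<close> the factor \<open>x - a\<close> is invertible, so
        the derivatives of \<open>Q\<close> vanish one after the other.\<close>
      hence nd: "\<not> int p dvd x - a" using assms(3) x a(1) by blast
      have "k < mu x" using k False by (simp add: mu'_def)
      thus ?thesis
      proof (induction k)
        case 0
        have "int p dvd poly R x" using Suc.prems(2)[OF x 0] by simp
        thus ?case using der[of 0 x] nd pp by (simp add: prime_dvd_mult_iff)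
      next
        case (Suc k)
        hence "int p dvd poly ((pderiv ^^ k) Q) x" by simp
        moreover have "int p dvd poly ((pderiv ^^ Suc k) R) x"
          using Suc.prems(1) \<open>\<And>a k. a \<in> A \<Longrightarrow> k < mu a \<Longrightarrow> int p dvd poly ((pderiv ^^ k) R) a\<close> x by blast
        ultimately have "int p dvd (x - a) * poly ((pderiv ^^ Suc k) Q) x"
          using der[of "Suc k" x] by (simp add: dvd_add_left_iff del: funpow.simps of_nat_Suc)
        thus ?case using nd pp by (simp add: prime_dvd_mult_iff del: funpow.simps)
      qed
    qed
    show "\<not> [:int p:] dvd Q" by (rule Q0)
  qed
  thus ?case using s deg by simp
qed simp

text \<open>Pigeonhole: there are more vectors of residues than possible right-hand sides, and the
  difference of two vectors with the same image is a solution.\<close>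

lemma exists_nontrivial_solution_mod_prime:
  fixes M :: "'c \<Rightarrow> 'i \<Rightarrow> int"
  assumes "prime p" "finite I" "finite C" "card C < card I"
  obtains x where "\<exists>i\<in>I. \<not> int p dvd x i" "\<And>c. c \<in> C \<Longrightarrow> int p dvd (\<Sum>i\<in>I. M c i * x i)"
proof -
  define X where "X = I \<rightarrow>\<^sub>E {0..<int p}"
  define F where "F x = restrict (\<lambda>c. (\<Sum>i\<in>I. M c i * x i) mod int p) C" for x
  have p: "p > 1" using assms(1) prime_gt_1_nat by blast
  have "F ` X \<subseteq> C \<rightarrow>\<^sub>E {0..<int p}" using p by (auto simp: F_def)
  moreover have "card (C \<rightarrow>\<^sub>E {0..<int p}) = p ^ card C"
    using assms(3) by (simp add: card_PiE)
  moreover have "card X = p ^ card I" using assms(2) by (simp add: X_def card_PiE)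
  moreover have "p ^ card C < p ^ card I" using p assms(4) by simp
  moreover have "finite (C \<rightarrow>\<^sub>E {0..<int p})" using assms(3) by (simp add: finite_PiE)
  ultimately have "\<not> inj_on F X" by (metis card_inj_on_le leD)
  then obtain x y where xy: "x \<in> X" "y \<in> X" "F x = F y" "x \<noteq> y"
    by (auto simp: inj_on_def)
  show thesis
  proof (rule that[of "\<lambda>i. x i - y i"])
    obtain i where i: "i \<in> I" "x i \<noteq> y i"
      using xy(1,2,4) unfolding X_def by (metis PiE_ext)
    have "x i \<in> {0..<int p}" "y i \<in> {0..<int p}" using xy i by (auto simp: X_def)
    hence "x i mod int p \<noteq> y i mod int p" using i by simp
    thus "\<exists>i\<in>I. \<not> int p dvd x i - y i" using i by (metis mod_eq_dvd_iff)
    fix c assume "c \<in> C"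
    hence "(\<Sum>i\<in>I. M c i * x i) mod int p = (\<Sum>i\<in>I. M c i * y i) mod int p"
      using fun_cong[OF xy(3), of c] by (simp add: F_def)
    thus "int p dvd (\<Sum>i\<in>I. M c i * (x i - y i))"
      by (simp add: mod_eq_dvd_iff right_diff_distrib sum_subtractf)
  qed
qed

section \<open>Stepanov's method for polynomials of odd degree\<close>

text \<open>What remains of the k-th derivative of \<open>f ^ c * u\<close> after the factor
  \<open>f ^ (c - k)\<close> is taken out.\<close>

fun twisted_pderiv :: "int poly \<Rightarrow> nat \<Rightarrow> int poly \<Rightarrow> nat \<Rightarrow> int poly" where
  "twisted_pderiv f c u 0 = u"
| "twisted_pderiv f c u (Suc k) =
     of_nat (c - k) * pderiv f * twisted_pderiv f c u k + f * pderiv (twisted_pderiv f c u k)"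

text \<open>Modulo \<open>p\<close> the power \<open>X ^ (p j)\<close> has derivative 0 and behaves
  like a constant.\<close>

lemma higher_pderiv_twisted:
  assumes "k \<le> c"
  shows "[:int p:] dvd (pderiv ^^ k) (f ^ c * u * monom 1 (p * j)) -
           f ^ (c - k) * twisted_pderiv f c u k * monom 1 (p * j)"
  using assms
proof (induction k)
  case (Suc k)
  define X :: "int poly" where "X = monom 1 (p * j)"
  define V where "V = twisted_pderiv f c u k"
  obtain d where d: "c - k = Suc d" "c - Suc k = d" using Suc.prems by (metis Suc_diff_Suc Suc_le_lessD)
  have X: "[:int p:] dvd pderiv X"
    by (simp add: X_def pderiv_monom const_poly_dvd_iff)
  have "[:int p:] dvd pderiv ((pderiv ^^ k) (f ^ c * u * X) - f ^ (c - k) * V * X)"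
    using Suc unfolding X_def V_def by (intro const_dvd_pderiv) simp
  hence "[:int p:] dvd (pderiv ^^ Suc k) (f ^ c * u * X) - pderiv (f ^ (c - k) * V * X)"
    by (simp add: pderiv_diff)
  moreover have "pderiv (f ^ (c - k) * V * X) =
      f ^ (c - Suc k) * twisted_pderiv f c u (Suc k) * X + f ^ (c - k) * V * pderiv X"
  proof -
    have P: "pderiv (f ^ (c - k)) = of_nat (c - k) * f ^ d * pderiv f"
      unfolding d(1) pderiv_power_Suc by (simp add: of_nat_poly del: of_nat_Suc)
    have F: "f ^ (c - k) = f ^ d * f" by (simp add: d(1))
    show ?thesis
      unfolding pderiv_mult P by (simp add: F d(2) V_def algebra_simps)
  qed
  moreover have "[:int p:] dvd f ^ (c - k) * V * pderiv X" using X by simp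
  ultimately have "[:int p:] dvd (pderiv ^^ Suc k) (f ^ c * u * X) -
      (f ^ (c - Suc k) * twisted_pderiv f c u (Suc k) * X + f ^ (c - k) * V * pderiv X)
      + f ^ (c - k) * V * pderiv X"
    by (metis dvd_add)
  thus ?case by (simp add: X_def)
qed simp

text \<open>The bound does not involve \<open>c\<close>. Hence the large exponent
  \<open>l + g\<close> costs nothing when the equations of the linear system are counted.\<close>

lemma degree_twisted_pderiv_le: "degree (twisted_pderiv f c u k) \<le> degree u + k * degree f"
proof (induction k)
  case (Suc k)
  let ?V = "twisted_pderiv f c u k"
  have "degree (of_nat (c - k) * pderiv f * ?V) \<le> degree (of_nat (c - k) * pderiv f) + degree ?V"
    by (rule degree_mult_le)
  also have "degree (of_nat (c - k) * pderiv f) \<le> degree f"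
    using degree_mult_le[of "of_nat (c - k)" "pderiv f"] by (simp add: degree_pderiv)
  finally have 1: "degree (of_nat (c - k) * pderiv f * ?V) \<le> degree f + degree ?V" by simp
  have "degree (f * pderiv ?V) \<le> degree f + degree (pderiv ?V)" by (rule degree_mult_le)
  hence 2: "degree (f * pderiv ?V) \<le> degree f + degree ?V" by (simp add: degree_pderiv)
  show ?case using degree_add_le[OF 1 2] Suc by simp
qed simp

lemma fermat_int:
  assumes "prime p"
  shows "[y ^ p = y] (mod int p)"
proof -
  define n where "n = nat (y mod int p)"
  have p: "p > 0" using assms prime_gt_0_nat by blast
  have n: "[y = int n] (mod int p)" using p by (simp add: n_def)
  have "[n ^ p = n] (mod p)"
  proof (cases "p dvd n")
    case True
    hence "p dvd n ^ p" using p by (meson dvd_power dvd_trans)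
    thus ?thesis using True by (meson cong_0_iff cong_sym cong_trans)
  next
    case False
    have "n ^ p = n ^ (p - 1) * n" using p by (simp add: power_eq_if)
    moreover have "[n ^ (p - 1) * n = 1 * n] (mod p)"
      using fermat_theorem[OF assms False] by (rule cong_scalar_right)
    ultimately show ?thesis by simp
  qed
  hence "[int n ^ p = int n] (mod int p)" by (metis cong_int_iff of_nat_power)
  thus ?thesis using cong_pow[OF n] n by (meson cong_sym cong_trans)
qed

text \<open>Modulo \<open>p\<close> the degrees \<open>m g \<sigma> + t + p j\<close> are pairwise distinct; this is the only
  place where the degree \<open>m = 2 h + 1\<close> of \<open>f\<close> has to be odd.\<close>

lemma stepanov_degrees_inj:
  fixes g h :: nat
  assumes "h \<le> g" "p = 2 * g + 1"
  shows "inj_on (\<lambda>(j, t, \<sigma>). (2 * h + 1) * (g * \<sigma>) + t + p * j) ({..<J} \<times> {..<g - h} \<times> {..<2})"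
proof (rule inj_onI)
  fix i i'
  assume i: "i \<in> {..<J} \<times> {..<g - h} \<times> {..<2}" "i' \<in> {..<J} \<times> {..<g - h} \<times> {..<2}"
    and eqi: "(case i of (j, t, \<sigma>) \<Rightarrow> (2 * h + 1) * (g * \<sigma>) + t + p * j) =
      (case i' of (j, t, \<sigma>) \<Rightarrow> (2 * h + 1) * (g * \<sigma>) + t + p * j)"
  obtain j t \<sigma> j' t' \<sigma>' where i_eq: "i = (j, t, \<sigma>)" "i' = (j', t', \<sigma>')"
    by (cases i, cases i')
  have a: "t < g - h" "\<sigma> < 2" "t' < g - h" "\<sigma>' < 2"
    "((2 * h + 1) * g) * \<sigma> + t + p * j = ((2 * h + 1) * g) * \<sigma>' + t' + p * j'"
    using i eqi by (simp_all add: i_eq algebra_simps)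
  \<comment> \<open>Division by \<open>p\<close> with remainder: for \<open>\<sigma> = 0\<close> and
    \<open>\<sigma> = 1\<close> the residues fill the disjoint blocks \<open>[0, g - h)\<close> and
    \<open>[g - h, 2 (g - h))\<close> below \<open>p\<close>.\<close>
  have eq: "(2 * h + 1) * g = p * h + (g - h)"
    using assms by (simp add: algebra_simps)
  define r where "r = (g - h) * \<sigma> + t"
  define r' where "r' = (g - h) * \<sigma>' + t'"
  have r: "r < p" "r' < p"
    using a assms by (auto simp: r_def r'_def less_2_cases_iff)
  have "p * (h * \<sigma> + j) + r = p * (h * \<sigma>' + j') + r'"
    using a(5) unfolding eq r_def r'_def by (simp add: algebra_simps)
  hence "(p * (h * \<sigma> + j) + r) mod p = (p * (h * \<sigma>' + j') + r') mod p" by simp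
  hence "r = r'" using r by simp
  moreover have "p > 0" using assms by simp
  ultimately have "h * \<sigma> + j = h * \<sigma>' + j'"
    using \<open>p * (h * \<sigma> + j) + r = p * (h * \<sigma>' + j') + r'\<close> by simp
  moreover have "\<sigma> = \<sigma>'" using \<open>r = r'\<close> a by (auto simp: r_def r'_def less_2_cases_iff)
  ultimately show "i = i'" using \<open>r = r'\<close> by (simp add: r_def r'_def i_eq)
qed

text \<open>The auxiliary polynomial is \<open>R = f ^ l (\<Sum>\<^sub>j (r\<^sub>j + s\<^sub>j f ^ g) X ^ (p j))\<close> with \<open>deg r\<^sub>j, deg s\<^sub>j < D\<close>. At a zero
  \<open>y\<close> of \<open>f ^ g - a\<close> modulo \<open>p\<close> its first \<open>l\<close> derivatives agree with polynomials of small degree, because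
  \<open>y ^ p = y\<close> and \<open>f(y) ^ g = a\<close>, and these are made to vanish identically.\<close>

lemma stepanov_count:
  fixes f :: "int poly" and a :: int
  assumes p: "prime p" "p = 2 * g + 1"
    and f: "degree f = 2 * h + 1" "\<not> int p dvd lead_coeff f"
    and size: "2 * s \<le> p" "h \<le> g" "g - h > s * (s + 1 + 2 * s * (2 * h + 1))"
  shows "2 * s * card {y \<in> {0..<int p}. [poly f y ^ g = a] (mod int p)} \<le>
    2 * s * (2 * h + 1) + (2 * h + 1) * g + (g - h) + p * s"
proof -
  define m where "m = 2 * h + 1"
  define D where "D = g - h"
  define J where "J = s + 1"
  define l where "l = 2 * s"
  define I where "I = {..<J} \<times> {..<D} \<times> {..<2::nat}"
  \<comment> \<open>Because of \<open>f ^ l\<close>, all terms still share the factor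
    \<open>f ^ (l - k)\<close> after \<open>k < l\<close> differentiations, so only the cofactors
    have to cancel.\<close>
  define E where "E = (\<lambda>(j, t, \<sigma>). f ^ (l + g * \<sigma>) * monom 1 t * monom 1 (p * j))"
  define W where "W = (\<lambda>k (j::nat, t, \<sigma>). twisted_pderiv f (l + g * \<sigma>) (monom 1 t) k)"
  define V where "V k i = (case i of (j, t, \<sigma>) \<Rightarrow> smult (a ^ \<sigma>) (W k i * monom 1 j))" for k i
  define C where "C = {..<l} \<times> {..<D + J + l * m}"
  \<comment> \<open>There are \<open>2 (s + 1) D\<close> unknowns and
    \<open>2 s (D + s + 1 + 2 s m)\<close> equations, one for each coefficient of each reduced
    derivative. Taking \<open>J = s + 1\<close> against \<open>l = 2 s\<close> gives the
    surplus.\<close>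
  have "s * (s + 1 + 2 * s * m) < D" using size by (simp add: m_def D_def)
  hence "s * (D + s + 1 + 2 * s * m) < (s + 1) * D" by (simp add: algebra_simps)
  hence "card C < card I"
    by (simp add: C_def I_def l_def J_def algebra_simps)
  then obtain x where x: "\<exists>i\<in>I. \<not> int p dvd x i"
    "\<And>c. c \<in> C \<Longrightarrow> int p dvd (\<Sum>i\<in>I. (case c of (k, n) \<Rightarrow> coeff (V k i) n) * x i)"
    using exists_nontrivial_solution_mod_prime[OF p(1), of I C "\<lambda>c i. case c of (k, n) \<Rightarrow> coeff (V k i) n"]
    unfolding I_def C_def by blast
  define R where "R = (\<Sum>i\<in>I. smult (x i) (E i))"
  have f0: "f \<noteq> 0" using f by auto
  have fin: "finite I" by (simp add: I_def)
  define dg where "dg = (\<lambda>(j::nat, t::nat, \<sigma>::nat). m * (g * \<sigma>) + t + p * j)"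
  have degE: "degree (E i) = l * m + dg i" and leadE: "\<not> int p dvd lead_coeff (E i)" for i
  proof -
    obtain j t \<sigma> where i: "i = (j, t, \<sigma>)" by (cases i)
    have "E i = f ^ (l + g * \<sigma>) * monom 1 (t + p * j)"
      by (simp add: E_def i mult_monom mult.assoc)
    moreover have "degree (f ^ (l + g * \<sigma>)) = (l + g * \<sigma>) * m"
      using f0 f(1) by (simp add: degree_power_eq m_def)
    ultimately show "degree (E i) = l * m + dg i"
      using f0 by (simp add: degree_mult_eq degree_monom_eq i dg_def algebra_simps)
    have "lead_coeff (E i) = lead_coeff f ^ (l + g * \<sigma>)"
      using \<open>E i = _\<close> by (simp add: lead_coeff_mult lead_coeff_power degree_monom_eq)
    thus "\<not> int p dvd lead_coeff (E i)"
      using f(2) p(1) by (simp add: prime_dvd_power_iff) (metis prime_dvd_power prime_nat_int_transfer)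
  qed
  have R0: "\<not> [:int p:] dvd R"
  proof -
    \<comment> \<open>Among the terms whose coefficient is nonzero modulo \<open>p\<close>, the one
      of largest degree is unique and cannot be cancelled.\<close>
    define I' where "I' = {i \<in> I. \<not> int p dvd x i}"
    have "finite I'" "I' \<noteq> {}" using x(1) fin by (auto simp: I'_def)
    then obtain i where "i \<in> I'" "dg i = Max (dg ` I')"
      by (metis (no_types, lifting) Max_in finite_imageI image_is_empty imageE)
    hence i: "i \<in> I'" "\<And>i'. i' \<in> I' \<Longrightarrow> dg i' \<le> dg i"
      using \<open>finite I'\<close> by auto
    define n where "n = degree (E i)"
    have "int p dvd (\<Sum>i'\<in>I - {i}. x i' * coeff (E i') n)"
    proof (rule dvd_sum)
      fix i' assume i': "i' \<in> I - {i}"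
      show "int p dvd x i' * coeff (E i') n"
      proof (cases "i' \<in> I'")
        case True
        have "inj_on dg I"
          using stepanov_degrees_inj[of h g p J] size p by (simp add: dg_def I_def D_def m_def)
        hence "dg i' \<noteq> dg i" using i' i(1) by (auto simp: I'_def inj_on_def)
        hence "degree (E i') < n" using i(2)[OF True] by (simp add: n_def degE)
        thus ?thesis by (simp add: coeff_eq_0)
      next
        case False
        thus ?thesis using i' by (simp add: I'_def)
      qed
    qed
    moreover have "\<not> int p dvd x i * coeff (E i) n"
      using i(1) leadE[of i] p(1) by (auto simp: n_def I'_def prime_dvd_mult_iff)
    moreover have "coeff R n = x i * coeff (E i) n + (\<Sum>i'\<in>I - {i}. x i' * coeff (E i') n)"
      using i(1) fin by (simp add: R_def coeff_sum I'_def sum.remove[of I i])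
    ultimately have "\<not> int p dvd coeff R n" by (simp add: dvd_add_left_iff)
    thus ?thesis by (auto simp: const_poly_dvd_iff)
  qed
  define Y where "Y = {y \<in> {0..<int p}. [poly f y ^ g = a] (mod int p)}"
  have degV: "degree (V k i) < D + J + l * m" if "i \<in> I" "k < l" for k i
  proof -
    obtain j t \<sigma> where i: "i = (j, t, \<sigma>)" by (cases i)
    have "degree (V k i) \<le> degree (W k i * monom 1 j)"
      by (simp add: V_def i degree_smult_le)
    also have "\<dots> \<le> degree (W k i) + j"
      using degree_mult_le[of "W k i" "monom 1 j"] degree_monom_le[of "1::int" j] by linarith
    also have "degree (W k i) \<le> t + k * m"
      using degree_twisted_pderiv_le[of f "l + g * \<sigma>" "monom 1 t" k] f(1)
      by (simp add: W_def i m_def degree_monom_eq)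
    also have "k * m \<le> l * m" using that by simp
    finally show ?thesis using that by (auto simp: I_def i)
  qed
  have vanish: "int p dvd poly ((pderiv ^^ k) R) y" if y: "y \<in> Y" and k: "k < l" for y k
  proof -
    have summand: "[poly ((pderiv ^^ k) (E i)) y = poly f y ^ (l - k) * poly (V k i) y] (mod int p)" for i
    proof -
      obtain j t \<sigma> where i: "i = (j, t, \<sigma>)" by (cases i)
      have "[:int p:] dvd (pderiv ^^ k) (E i) - f ^ (l + g * \<sigma> - k) * W k i * monom 1 (p * j)"
        using higher_pderiv_twisted[of k "l + g * \<sigma>" p f "monom 1 t" j] k by (simp add: E_def W_def i)
      hence "[poly ((pderiv ^^ k) (E i)) y =
          poly f y ^ (l + g * \<sigma> - k) * poly (W k i) y * y ^ (p * j)] (mod int p)"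
        by (auto dest!: const_dvd_poly[where x = y] simp: cong_iff_dvd_diff poly_monom)
      also have "l + g * \<sigma> - k = (l - k) + g * \<sigma>" using k by simp
      also have "poly f y ^ (l - k + g * \<sigma>) * poly (W k i) y * y ^ (p * j) =
          poly f y ^ (l - k) * ((poly f y ^ g) ^ \<sigma> * poly (W k i) y * (y ^ p) ^ j)"
        by (simp add: power_add power_mult mult.assoc)
      also have "[\<dots> = poly f y ^ (l - k) * (a ^ \<sigma> * poly (W k i) y * y ^ j)] (mod int p)"
        using y fermat_int[OF p(1), of y] by (intro cong_mult cong_pow cong_refl) (auto simp: Y_def)
      also have "a ^ \<sigma> * poly (W k i) y * y ^ j = poly (V k i) y"
        by (simp add: V_def i poly_monom)
      finally show ?thesis .
    qed
    define Q where "Q = (\<Sum>i\<in>I. smult (x i) (V k i))"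
    have "[:int p:] dvd Q"
      unfolding const_poly_dvd_iff
    proof
      fix n
      show "int p dvd coeff Q n"
      proof (cases "n < D + J + l * m")
        case True
        hence "(k, n) \<in> C" using k by (simp add: C_def)
        from x(2)[OF this] show ?thesis by (simp add: Q_def coeff_sum mult.commute)
      next
        case False
        hence "coeff (V k i) n = 0" if "i \<in> I" for i
          using degV[OF that k] by (simp add: coeff_eq_0)
        thus ?thesis by (simp add: Q_def coeff_sum)
      qed
    qed
    hence Q: "int p dvd poly Q y" by (rule const_dvd_poly)
    have "poly ((pderiv ^^ k) R) y = (\<Sum>i\<in>I. x i * poly ((pderiv ^^ k) (E i)) y)"
      by (simp add: R_def higher_pderiv_sum higher_pderiv_smult poly_sum)
    also have "[\<dots> = (\<Sum>i\<in>I. x i * (poly f y ^ (l - k) * poly (V k i) y))] (mod int p)"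
      by (intro cong_sum cong_mult cong_refl summand)
    also have "(\<Sum>i\<in>I. x i * (poly f y ^ (l - k) * poly (V k i) y)) = poly f y ^ (l - k) * poly Q y"
      by (simp add: Q_def poly_sum sum_distrib_left algebra_simps)
    also have "[\<dots> = 0] (mod int p)" using Q by (simp add: cong_0_iff)
    finally show ?thesis by (simp add: cong_0_iff)
  qed
  have "(\<Sum>y\<in>Y. l) \<le> degree R"
  proof (rule sum_root_multiplicities_mod_prime_le[OF p(1) _ _ _ _ R0])
    show "finite Y" unfolding Y_def by (rule finite_subset[of _ "{0..<int p}"]) auto
    show "y = y'" if "y \<in> Y" "y' \<in> Y" "int p dvd y - y'" for y y'
      using that by (auto simp: Y_def mod_eq_dvd_iff[symmetric])
  qed (use size vanish in \<open>auto simp: l_def\<close>)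
  also have "degree R \<le> l * m + (m * g + D + p * s)"
    unfolding R_def
  proof (rule degree_sum_le[OF fin])
    fix i assume "i \<in> I"
    then obtain j t \<sigma> where i: "i = (j, t, \<sigma>)" "j \<le> s" "t < D" "\<sigma> \<le> 1"
      by (auto simp: I_def J_def)
    have "degree (smult (x i) (E i)) \<le> l * m + dg i" by (metis degE degree_smult_le)
    also have "dg i \<le> m * (g * 1) + D + p * s"
      unfolding i(1) dg_def prod.case using i by (intro add_mono mult_le_mono) auto
    finally show "degree (smult (x i) (E i)) \<le> l * m + (m * g + D + p * s)" by simp
  qed
  finally show ?thesis
    by (simp add: Y_def l_def m_def D_def algebra_simps)
qed

section \<open>Character sums from the Stepanov count\<close>

lemma Legendre_cases: "Legendre a p = 0 \<or> Legendre a p = 1 \<or> Legendre a p = - 1"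
  by (simp add: Legendre_def)

lemma Legendre_eq_0_iff: "Legendre a p = 0 \<longleftrightarrow> p dvd a"
  by (auto simp: Legendre_def cong_0_iff)

text \<open>By Euler's criterion the count bounds the arguments with symbol 1, and those with symbol
  -1, by little more than \<open>p / 2\<close>. Apart from the few zeros of \<open>f\<close> the two
  classes exhaust all \<open>p\<close> residues, so an upper bound for one is a lower bound for the
  other.\<close>

lemma legendre_sum_odd_degree_le:
  fixes f :: "int poly"
  assumes p: "prime p" "p = 2 * g + 1"
    and f: "degree f = 2 * h + 1" "\<not> int p dvd lead_coeff f"
    and size: "2 * s \<le> p" "h \<le> g" "g - h > s * (s + 1 + 2 * s * (2 * h + 1))"
  shows "int s * \<bar>\<Sum>y\<in>{0..<int p}. Legendre (poly f y) (int p)\<bar> \<le> 3 * int s * (2 * int h + 1) + int p * (int h + 1)"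
proof -
  define Z where "Z c = {y \<in> {0..<int p}. Legendre (poly f y) (int p) = c}" for c
  have fin: "finite (Z c)" for c unfolding Z_def by (rule finite_subset[of _ "{0..<int p}"]) auto
  have g: "p > 2" "(p - 1) div 2 = g" using p prime_ge_2_nat[OF p(1)] by auto
  have bound: "2 * int s * int (card (Z c)) \<le> 2 * int s * (2 * int h + 1) + int p * (int s + int h + 1)" for c
  proof -
    define Y where "Y = {y \<in> {0..<int p}. [poly f y ^ g = c] (mod int p)}"
    have "finite Y" unfolding Y_def by (rule finite_subset[of _ "{0..<int p}"]) auto
    moreover have "Z c \<subseteq> Y"
    proof
      fix y assume "y \<in> Z c"
      thus "y \<in> Y" using euler_criterion[OF p(1) g(1), of "poly f y"] g(2)
        by (auto simp: Z_def Y_def cong_sym_eq)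
    qed
    ultimately have "2 * s * card (Z c) \<le> 2 * s * card Y" by (simp add: card_mono)
    also have "\<dots> \<le> 2 * s * (2 * h + 1) + (2 * h + 1) * g + (g - h) + p * s"
      unfolding Y_def by (rule stepanov_count[OF p f size])
    also have "\<dots> \<le> 2 * s * (2 * h + 1) + p * (s + h + 1)"
      using p(2) by (simp add: algebra_simps)
    finally have "int (2 * s * card (Z c)) \<le> int (2 * s * (2 * h + 1) + p * (s + h + 1))"
      by (simp only: of_nat_le_iff)
    thus ?thesis by (simp add: algebra_simps)
  qed
  have "(\<Sum>y\<in>Z 0. 1) \<le> degree f"
  proof (rule sum_root_multiplicities_mod_prime_le[OF p(1)])
    show "y = y'" if "y \<in> Z 0" "y' \<in> Z 0" "int p dvd y - y'" for y y'
      using that by (auto simp: Z_def mod_eq_dvd_iff[symmetric])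
    show "\<not> [:int p:] dvd f" using f(2) by (auto simp: const_poly_dvd_iff)
  qed (use fin[of 0] p(2) in \<open>simp_all add: Z_def Legendre_eq_0_iff\<close>)
  hence Z0: "int (card (Z 0)) \<le> 2 * int h + 1" using f by simp
  have ind: "(\<Sum>y\<in>{0..<int p}. of_bool (Legendre (poly f y) (int p) = c)) = int (card (Z c))" for c
    by (simp add: Z_def sum.If_cases of_bool_def Int_def conj_commute)
  have "(\<Sum>y\<in>{0..<int p}. (1::int)) = (\<Sum>y\<in>{0..<int p}.
      of_bool (Legendre (poly f y) (int p) = 0) + of_bool (Legendre (poly f y) (int p) = 1)
      + of_bool (Legendre (poly f y) (int p) = -1))"
    by (intro sum.cong refl) (use Legendre_cases[of "poly f _" "int p"] in force)
  hence total: "int p = int (card (Z 0)) + int (card (Z 1)) + int (card (Z (-1)))"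
    by (simp only: sum.distrib ind) simp
  have "(\<Sum>y\<in>{0..<int p}. Legendre (poly f y) (int p)) = (\<Sum>y\<in>{0..<int p}.
      of_bool (Legendre (poly f y) (int p) = 1) - of_bool (Legendre (poly f y) (int p) = -1))"
    by (intro sum.cong refl) (use Legendre_cases[of "poly f _" "int p"] in force)
  hence S: "(\<Sum>y\<in>{0..<int p}. Legendre (poly f y) (int p)) = int (card (Z 1)) - int (card (Z (-1)))"
    by (simp only: sum_subtractf ind)
  have "int s * int (card (Z 0)) \<le> int s * (2 * int h + 1)" using Z0 by (intro mult_left_mono) auto
  moreover have "int s * int p = int s * int (card (Z 0)) + int s * int (card (Z 1)) + int s * int (card (Z (-1)))"
    unfolding total by (simp add: distrib_left)
  ultimately show ?thesis
    using bound[of 1] bound[of "-1"] unfolding S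
    by (simp add: abs_if algebra_simps)
qed

lemma legendre_sum_odd_degree:
  fixes e :: real
  assumes "e > 0"
  obtains P where "\<And>p f. prime p \<Longrightarrow> p \<ge> P \<Longrightarrow> degree f = 2 * h + 1 \<Longrightarrow> \<not> int p dvd lead_coeff f \<Longrightarrow>
    \<bar>real_of_int (\<Sum>y\<in>{0..<int p}. Legendre (poly f y) (int p))\<bar> \<le> e * real p"
proof -
  \<comment> \<open>\<open>s\<close> makes the main term \<open>p (h + 1) / s\<close> at most
    \<open>e p / 2\<close>, and \<open>P1\<close> does the same for the bounded term
    \<open>3 (2 h + 1)\<close>.\<close>
  obtain s :: nat where s: "s > 2 * (real h + 1) / e" using reals_Archimedean2 by blast
  have "s > 0" using s assms by (metis divide_nonneg_pos gr0I mult_nonneg_nonneg of_nat_0 of_nat_0_le_iff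
    not_less add_nonneg_nonneg zero_le_numeral zero_le_one)
  obtain P1 :: nat where P1: "P1 > 6 * (2 * real h + 1) / e" using reals_Archimedean2 by blast
  show thesis
  proof (rule that)
    fix p f assume p: "prime p" and f: "degree f = 2 * h + 1" "\<not> int p dvd lead_coeff f"
      and P: "p \<ge> P1 + 3 + 2 * (h + 1 + s + s * (s + 1 + 2 * s * (2 * h + 1)))"
    have "odd p" using prime_odd_nat[OF p] P by simp
    then obtain g where g: "p = 2 * g + 1" by (rule oddE)
    have "2 * s \<le> p" "h \<le> g" "g - h > s * (s + 1 + 2 * s * (2 * h + 1))" using P g by auto
    from legendre_sum_odd_degree_le[OF p g f this]
    have "real_of_int (int s * \<bar>\<Sum>y\<in>{0..<int p}. Legendre (poly f y) (int p)\<bar>) \<le>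
        real_of_int (3 * int s * (2 * int h + 1) + int p * (int h + 1))"
      by (simp only: of_int_le_iff)
    hence "real s * \<bar>real_of_int (\<Sum>y\<in>{0..<int p}. Legendre (poly f y) (int p))\<bar> \<le>
        real s * (3 * (2 * real h + 1)) + real p * (real h + 1)"
      by (simp add: algebra_simps)
    also have "\<dots> \<le> real s * (e / 2 * real p) + real p * (real s * (e / 2))"
    proof (intro add_mono mult_left_mono)
      show "real h + 1 \<le> real s * (e / 2)" using s assms by (simp add: field_simps)
      have "6 * (2 * real h + 1) \<le> e * P1" using P1 assms by (simp add: field_simps)
      also have "\<dots> \<le> e * p" using P assms by simp
      finally show "3 * (2 * real h + 1) \<le> e / 2 * real p" by simp
    qed auto
    also have "\<dots> = real s * (e * real p)" by simp
    finally show "\<bar>real_of_int (\<Sum>y\<in>{0..<int p}. Legendre (poly f y) (int p))\<bar> \<le> e * real p"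
      using \<open>s > 0\<close> by simp
  qed
qed

section \<open>The Legendre symbol\<close>

lemma Legendre_cong: "[a = b] (mod p) \<Longrightarrow> Legendre a p = Legendre b p"
proof -
  assume "[a = b] (mod p)"
  hence "[x = a] (mod p) \<longleftrightarrow> [x = b] (mod p)" "[a = x] (mod p) \<longleftrightarrow> [b = x] (mod p)" for x
    by (simp_all add: cong_def)
  thus ?thesis by (simp add: Legendre_def QuadRes_def)
qed

text \<open>Two such values differ by at most 2, which is less than the modulus.\<close>

lemma Legendre_eqI:
  fixes x y :: int
  assumes "x \<in> {-1, 0, 1}" "y \<in> {-1, 0, 1}" "[x = y] (mod p)" "p > 2"
  shows "x = y"
proof -
  have "p dvd x - y" using assms(3) by (simp add: cong_iff_dvd_diff)
  moreover have "\<bar>x - y\<bar> < p" using assms by auto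
  ultimately have "x - y = 0" using dvd_imp_le_int[of "x - y" p] by force
  thus ?thesis by simp
qed

lemma Legendre_mult:
  assumes "prime p" "p > 2"
  shows "Legendre (a * b) (int p) = Legendre a (int p) * Legendre b (int p)"
proof (rule Legendre_eqI)
  show "Legendre (a * b) (int p) \<in> {-1, 0, 1}" using Legendre_cases by blast
  show "Legendre a (int p) * Legendre b (int p) \<in> {-1, 0, 1}"
    using Legendre_cases[of a "int p"] Legendre_cases[of b "int p"] by auto
  have "[Legendre (a * b) (int p) = a ^ ((p - 1) div 2) * b ^ ((p - 1) div 2)] (mod int p)"
    using euler_criterion[OF assms, of "a * b"] by (simp add: power_mult_distrib)
  thus "[Legendre (a * b) (int p) = Legendre a (int p) * Legendre b (int p)] (mod int p)"
    using euler_criterion[OF assms, of a] euler_criterion[OF assms, of b]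
    by (meson cong_mult cong_sym cong_trans)
qed (use assms in auto)

lemma Legendre_1: "p > 1 \<Longrightarrow> Legendre 1 (int p) = 1"
  by (auto simp: Legendre_def QuadRes_def cong_0_iff intro!: exI[of _ 1])

lemma Legendre_prod:
  assumes "prime p" "p > 2"
  shows "Legendre (\<Prod>i\<in>I. f i) (int p) = (\<Prod>i\<in>I. Legendre (f i) (int p))"
  by (induction I rule: infinite_finite_induct) (use assms in \<open>auto simp: Legendre_mult Legendre_1\<close>)

lemma Legendre_sq:
  "\<not> p dvd a \<Longrightarrow> Legendre a p * Legendre a p = 1"
  using Legendre_cases[of a p] Legendre_eq_0_iff[of a p] by auto

section \<open>Sums over products of linear forms\<close>

lemma modular_inverse_exists:
  assumes "prime p" "\<not> int p dvd x"
  obtains y where "y \<in> {1..<int p}" "[x * y = 1] (mod int p)"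
proof -
  have "coprime x (int p)"
    using prime_imp_coprime[of "int p" x] assms by (simp add: coprime_commute)
  then obtain y where y: "[x * y = 1] (mod int p)" using cong_solve_coprime_int by blast
  have p: "p > 1" using assms(1) prime_gt_1_nat by blast
  have "[x * (y mod int p) = 1] (mod int p)"
    using y by (simp add: cong_def mod_mult_right_eq)
  moreover from this have "y mod int p \<noteq> 0" using p by (auto simp: cong_def)
  moreover have "y mod int p \<ge> 0" "y mod int p < int p" using p by auto
  ultimately show thesis using that[of "y mod int p"] by auto
qed

lemma cong_inverse_unique:
  fixes x y z :: int
  assumes "[x * y = 1] (mod p)" "[x * z = 1] (mod p)"
  shows "[y = z] (mod p)"
proof -
  have "[(x * z) * y = 1 * y] (mod p)" using assms(2) by (rule cong_scalar_right)
  moreover have "[(x * y) * z = 1 * z] (mod p)" using assms(1) by (rule cong_scalar_right)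
  ultimately show ?thesis by (metis cong_sym cong_trans mult.assoc mult.commute mult_1)
qed

lemma cong_interval_eq:
  fixes y z :: int
  assumes "[y = z] (mod p)" "y \<in> {0..<p}" "z \<in> {0..<p}"
  shows "y = z"
  using assms by (simp add: cong_def)

text \<open>The substitution is \<open>w = 1 / (u\<^sub>0 n + v\<^sub>0)\<close>; as the number of forms is even, the powers of \<open>w\<close> that it
  introduces do not change the quadratic character.\<close>

lemma legendre_sum_even_forms_eq:
  fixes u v :: "'i \<Rightarrow> int"
  assumes p: "prime p" "p > 2" and I: "finite I" "even (card I)" "i0 \<in> I"
    and u: "\<not> int p dvd u i0"
  defines "f \<equiv> \<Prod>i\<in>I - {i0}. [:u i, u i0 * v i - u i * v i0:]"
  shows "(\<Sum>n\<in>{0..<int p}. Legendre (\<Prod>i\<in>I. u i * n + v i) (int p)) =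
    Legendre (u i0) (int p) * (\<Sum>w\<in>{1..<int p}. Legendre (poly f w) (int p))"
proof -
  let ?L = "\<lambda>a. Legendre a (int p)"
  define x where "x n = u i0 * n + v i0" for n
  define A where "A = {n \<in> {0..<int p}. \<not> int p dvd x n}"
  define iv where "iv a = (SOME y. y \<in> {1..<int p} \<and> [a * y = 1] (mod int p))" for a
  have iv: "iv a \<in> {1..<int p}" "[a * iv a = 1] (mod int p)" if a: "\<not> int p dvd a" for a
    using someI_ex[of "\<lambda>y. y \<in> {1..<int p} \<and> [a * y = 1] (mod int p)"]
      modular_inverse_exists[OF p(1) a] unfolding iv_def by metis+
  have pos: "int p > 0" using p by simp
  obtain u' where u': "[u i0 * u' = 1] (mod int p)" using modular_inverse_exists[OF p(1) u] by blast
  have oddc: "odd (card (I - {i0}))" using I by (auto simp: card_Diff_singleton card_gt_0_iff)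
  have powL: "?L a ^ card (I - {i0}) = ?L a" for a
    using oddc Legendre_cases[of a "int p"] by (auto simp: power_0_left odd_pos)
  have ndvd: "\<not> int p dvd a" "\<not> int p dvd b" if "[a * b = 1] (mod int p)" for a b
    using cong_dvd_iff[OF that] p by (auto simp: zdvd1_eq)
  have "(\<Sum>n\<in>{0..<int p}. ?L (\<Prod>i\<in>I. u i * n + v i)) = (\<Sum>n\<in>A. ?L (\<Prod>i\<in>I. u i * n + v i))"
  proof (rule sum.mono_neutral_right)
    show "\<forall>n\<in>{0..<int p} - A. ?L (\<Prod>i\<in>I. u i * n + v i) = 0"
    proof
      fix n assume "n \<in> {0..<int p} - A"
      hence "int p dvd u i0 * n + v i0" by (auto simp: A_def x_def)
      also have "\<dots> dvd (\<Prod>i\<in>I. u i * n + v i)" by (rule dvd_prodI[OF I(1,3)])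
      finally show "?L (\<Prod>i\<in>I. u i * n + v i) = 0" by (simp add: Legendre_eq_0_iff)
    qed
  qed (auto simp: A_def)
  also have "\<dots> = (\<Sum>w\<in>{1..<int p}. ?L (u i0) * ?L (poly f w))"
  proof (rule sum.reindex_bij_witness[where j = "\<lambda>n. iv (x n)" and
        i = "\<lambda>w. (u' * (iv w - v i0)) mod int p"])
    fix n assume n: "n \<in> A"
    hence nd: "\<not> int p dvd x n" by (simp add: A_def)
    define w where "w = iv (x n)"
    have w: "w \<in> {1..<int p}" "[x n * w = 1] (mod int p)" using iv[OF nd] by (auto simp: w_def)
    show "iv (x n) \<in> {1..<int p}" by (rule iv(1)[OF nd])
    have ndw: "\<not> int p dvd w" using ndvd(2)[OF w(2)] .
    have "[iv w = x n] (mod int p)"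
      using cong_inverse_unique[of w "iv w" "int p" "x n"] iv(2)[OF ndw] w(2) by (simp add: mult.commute)
    hence "[u' * (iv w - v i0) = u' * (x n - v i0)] (mod int p)"
      by (intro cong_mult cong_diff cong_refl)
    also have "u' * (x n - v i0) = (u i0 * u') * n" by (simp add: x_def)
    also have "[(u i0 * u') * n = 1 * n] (mod int p)" using u' by (rule cong_scalar_right)
    finally show "(u' * (iv (iv (x n)) - v i0)) mod int p = n"
      using n by (simp add: cong_def A_def w_def)
    have "poly f w = (\<Prod>i\<in>I - {i0}. u i + w * (u i0 * v i - u i * v i0))"
      by (simp add: f_def poly_prod)
    also have "[\<dots> = (\<Prod>i\<in>I - {i0}. u i0 * w * (u i * n + v i))] (mod int p)"
    proof (rule cong_prod)
      fix i
      \<comment> \<open>Writing the constant coefficient \<open>u i\<close> as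
        \<open>u i * (x n * w)\<close> makes \<open>u i0 * w\<close> a common factor.\<close>
      have "[u i * (x n * w) + w * (u i0 * v i - u i * v i0) = u i * 1 + w * (u i0 * v i - u i * v i0)] (mod int p)"
        using w(2) by (intro cong_add cong_mult cong_refl)
      moreover have "u i * (x n * w) + w * (u i0 * v i - u i * v i0) = u i0 * w * (u i * n + v i)"
        by (simp add: x_def algebra_simps)
      ultimately show "[u i + w * (u i0 * v i - u i * v i0) = u i0 * w * (u i * n + v i)] (mod int p)"
        by (simp add: cong_sym)
    qed
    finally have "?L (poly f w) = ?L (\<Prod>i\<in>I - {i0}. u i0 * w * (u i * n + v i))"
      by (rule Legendre_cong)
    also have "\<dots> = (\<Prod>i\<in>I - {i0}. ?L (u i0) * ?L w * ?L (u i * n + v i))"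
      by (simp only: Legendre_prod[OF p] Legendre_mult[OF p])
    \<comment> \<open>The number of factors is odd, so each of the two signs survives exactly once;
      \<open>?L w = ?L (x n)\<close> then puts the missing form \<open>i0\<close> back.\<close>
    also have "\<dots> = ?L (u i0) * ?L w * (\<Prod>i\<in>I - {i0}. ?L (u i * n + v i))"
      by (simp only: prod.distrib prod_constant powL)
    finally have "?L (poly f w) = ?L (u i0) * ?L w * (\<Prod>i\<in>I - {i0}. ?L (u i * n + v i))" .
    moreover have "?L (x n) * ?L w = 1"
      using Legendre_cong[OF w(2)] p by (simp add: Legendre_mult[OF p] Legendre_1)
    hence "?L w = ?L (x n)"
      using Legendre_cases[of w "int p"] Legendre_cases[of "x n" "int p"] by auto
    moreover have "?L (u i0) * ?L (u i0) = 1" using Legendre_sq[OF u] .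
    ultimately have "?L (u i0) * ?L (poly f w) = ?L (x n) * (\<Prod>i\<in>I - {i0}. ?L (u i * n + v i))"
      by (simp flip: mult.assoc)
    thus "?L (u i0) * ?L (poly f (iv (x n))) = ?L (\<Prod>i\<in>I. u i * n + v i)"
      using I by (simp add: w_def Legendre_prod[OF p] Legendre_mult[OF p] prod.remove[of I i0] x_def)
  next
    fix w assume w: "w \<in> {1..<int p}"
    hence ndw: "\<not> int p dvd w" by (auto dest: zdvd_imp_le)
    define n where "n = (u' * (iv w - v i0)) mod int p"
    have "[x n = u i0 * (u' * (iv w - v i0)) + v i0] (mod int p)"
      unfolding x_def n_def by (intro cong_add cong_mult cong_refl) simp
    also have "u i0 * (u' * (iv w - v i0)) + v i0 = (u i0 * u') * (iv w - v i0) + v i0" by simp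
    also have "[\<dots> = 1 * (iv w - v i0) + v i0] (mod int p)"
      using u' by (intro cong_add cong_mult cong_refl)
    finally have x: "[x n = iv w] (mod int p)" by simp
    have "[x n * w = iv w * w] (mod int p)" using x by (rule cong_scalar_right)
    also have "iv w * w = w * iv w" by simp
    also have "[w * iv w = 1] (mod int p)" by (rule iv(2)[OF ndw])
    finally have xw: "[x n * w = 1] (mod int p)" .
    have nd: "\<not> int p dvd x n" using ndvd(1)[OF xw] .
    thus "(u' * (iv w - v i0)) mod int p \<in> A" using pos by (simp add: A_def n_def)
    have "[iv (x n) = w] (mod int p)" by (rule cong_inverse_unique[OF iv(2)[OF nd] xw])
    thus "iv (x ((u' * (iv w - v i0)) mod int p)) = w"
      using cong_interval_eq[of "iv (x n)" w "int p"] iv(1)[OF nd] w by (simp add: n_def)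
  qed
  finally show ?thesis by (simp add: sum_distrib_left)
qed

lemma eventually_not_dvd:
  fixes c :: int
  assumes "c \<noteq> 0"
  shows "\<forall>\<^sub>F p in at_top. \<not> int p dvd c"
  using eventually_gt_at_top[of "nat \<bar>c\<bar>"]
proof eventually_elim
  case (elim p)
  thus ?case using dvd_imp_le_int[OF assms, of "int p"] by auto
qed

text \<open>After the inversion of the form \<open>i0\<close> the polynomial has the odd degree
  \<open>card I - 1\<close>, because \<open>uv\<close> makes each of its factors genuinely
  linear.\<close>

lemma legendre_sum_even_forms:
  fixes u v :: "'i \<Rightarrow> int" and e :: real
  assumes I: "finite I" "even (card I)" "i0 \<in> I"
    and u: "\<And>i. i \<in> I \<Longrightarrow> u i \<noteq> 0"
    and uv: "\<And>i. i \<in> I - {i0} \<Longrightarrow> u i0 * v i - u i * v i0 \<noteq> 0"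
    and e: "e > 0"
  shows "\<forall>\<^sub>F p in at_top. prime p \<longrightarrow>
    \<bar>real_of_int (\<Sum>n\<in>{0..<int p}. Legendre (\<Prod>i\<in>I. u i * n + v i) (int p))\<bar> \<le> e * real p"
proof -
  define f where "f = (\<Prod>i\<in>I - {i0}. [:u i, u i0 * v i - u i * v i0:])"
  have "odd (card (I - {i0}))" using I by (auto simp: card_Diff_singleton card_gt_0_iff)
  then obtain h where h: "card (I - {i0}) = 2 * h + 1" by (rule oddE)
  have deg: "degree f = 2 * h + 1"
    using uv h by (simp add: f_def degree_prod_eq_sum_degree del: card_Diff_singleton card_Diff_insert)
  have lead: "lead_coeff f = (\<Prod>i\<in>I - {i0}. u i0 * v i - u i * v i0)"
    unfolding f_def lead_coeff_prod by (intro prod.cong refl) (use uv in simp)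
  hence "lead_coeff f \<noteq> 0" using uv I(1) by simp
  hence ev1: "\<forall>\<^sub>F p in at_top. \<not> int p dvd lead_coeff f" by (rule eventually_not_dvd)
  have ev2: "\<forall>\<^sub>F p in at_top. \<not> int p dvd u i0" using u I(3) by (intro eventually_not_dvd)
  obtain P where P: "\<And>p f. prime p \<Longrightarrow> p \<ge> P \<Longrightarrow> degree f = 2 * h + 1 \<Longrightarrow> \<not> int p dvd lead_coeff f \<Longrightarrow>
    \<bar>real_of_int (\<Sum>y\<in>{0..<int p}. Legendre (poly f y) (int p))\<bar> \<le> e / 2 * real p"
    using legendre_sum_odd_degree[of "e / 2" h] e by auto
  obtain P' :: nat where P': "P' > 2 / e" using reals_Archimedean2 by blast
  show ?thesis
    using ev1 ev2 eventually_ge_at_top[of P] eventually_ge_at_top[of P'] eventually_gt_at_top[of 2]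
  proof eventually_elim
    case (elim p)
    show ?case
    proof
      assume p: "prime p"
      let ?L = "\<lambda>a. Legendre a (int p)"
      have ab: "\<bar>?L a\<bar> \<le> 1" for a using Legendre_cases[of a "int p"] by auto
      define T where "T = (\<Sum>w\<in>{1..<int p}. ?L (poly f w))"
      \<comment> \<open>The inverse \<open>w\<close> never takes the value 0; adding this argument
        completes the sum and costs at most 1.\<close>
      have "{0..<int p} = insert 0 {1..<int p}" using elim by auto
      hence full: "(\<Sum>y\<in>{0..<int p}. ?L (poly f y)) = ?L (poly f 0) + T" by (simp add: T_def)
      have "(\<Sum>n\<in>{0..<int p}. ?L (\<Prod>i\<in>I. u i * n + v i)) = ?L (u i0) * T"
        unfolding T_def f_def by (rule legendre_sum_even_forms_eq) (use p elim I in auto)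
      hence "\<bar>\<Sum>n\<in>{0..<int p}. ?L (\<Prod>i\<in>I. u i * n + v i)\<bar> \<le> \<bar>T\<bar>"
        using ab[of "u i0"] by (simp add: abs_mult mult_left_le_one_le)
      also have "\<bar>T\<bar> \<le> \<bar>\<Sum>y\<in>{0..<int p}. ?L (poly f y)\<bar> + 1"
        using ab[of "poly f 0"] unfolding full by linarith
      finally have "\<bar>real_of_int (\<Sum>n\<in>{0..<int p}. ?L (\<Prod>i\<in>I. u i * n + v i))\<bar> \<le>
          \<bar>real_of_int (\<Sum>y\<in>{0..<int p}. ?L (poly f y))\<bar> + 1"
        by linarith
      also have "\<dots> \<le> e / 2 * real p + 1" using P[OF p _ deg] elim by simp
      also have "1 \<le> e / 2 * P'" using P' e by (simp add: field_simps)
      also have "\<dots> \<le> e / 2 * real p" using elim e by simp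
      finally show "\<bar>real_of_int (\<Sum>n\<in>{0..<int p}. ?L (\<Prod>i\<in>I. u i * n + v i))\<bar> \<le> e * real p"
        by simp
    qed
  qed
qed

section \<open>Incomplete sums\<close>

text \<open>Cauchy-Schwarz against the constant 1, read off from the sum of all squared
  differences.\<close>

lemma sum_squared_le_card_mult:
  fixes G :: "'a \<Rightarrow> real"
  shows "(\<Sum>i\<in>I. G i)\<^sup>2 \<le> real (card I) * (\<Sum>i\<in>I. (G i)\<^sup>2)"
proof -
  have "0 \<le> (\<Sum>i\<in>I. \<Sum>j\<in>I. (G i - G j)\<^sup>2)" by (intro sum_nonneg) auto
  also have "\<dots> = 2 * (real (card I) * (\<Sum>i\<in>I. (G i)\<^sup>2)) - 2 * (\<Sum>i\<in>I. G i)\<^sup>2"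
    by (simp add: power2_diff sum.distrib sum_subtractf power2_eq_square[of "sum G I"] sum_product
        sum_distrib_left sum_distrib_right mult_ac)
  finally show ?thesis by simp
qed

text \<open>Van der Corput's argument: average the sum over the shifts \<open>h < H\<close> and apply Cauchy-Schwarz.\<close>

lemma van_der_corput_shift:
  fixes F :: "nat \<Rightarrow> real"
  assumes F: "\<And>n. \<bar>F n\<bar> \<le> 1" and H: "H > 0" and N: "N \<le> M" and B: "B \<ge> 0"
    and corr: "\<And>h h'. h < H \<Longrightarrow> h' < H \<Longrightarrow> h \<noteq> h' \<Longrightarrow> \<bar>\<Sum>n<M. F (n + h) * F (n + h')\<bar> \<le> B"
  shows "real H * \<bar>\<Sum>n<N. F n\<bar> \<le> sqrt (real M * (real H * real M + (real H)\<^sup>2 * B)) + (real H)\<^sup>2"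
proof -
  define G where "G n = (\<Sum>h<H. F (n + h))" for n
  \<comment> \<open>Each shift by one exchanges a single term at either end.\<close>
  have shift: "\<bar>(\<Sum>n<N. F n) - (\<Sum>n<N. F (n + h))\<bar> \<le> 2 * real h" for h
  proof (induction h)
    case (Suc h)
    have "(\<Sum>n<N. F (n + h)) - (\<Sum>n<N. F (n + Suc h)) = F h - F (N + h)"
      using sum_lessThan_telescope'[of "\<lambda>n. F (n + h)" N] by (simp add: sum_subtractf)
    thus ?case using Suc F[of h] F[of "N + h"] by (simp add: abs_le_iff)
  qed simp
  have "(\<Sum>n<N. G n) = (\<Sum>h<H. \<Sum>n<N. F (n + h))" unfolding G_def by (rule sum.swap)
  hence "real H * (\<Sum>n<N. F n) - (\<Sum>n<N. G n) = (\<Sum>h<H. (\<Sum>n<N. F n) - (\<Sum>n<N. F (n + h)))"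
    by (simp add: sum_subtractf)
  also have "\<bar>\<dots>\<bar> \<le> (\<Sum>h<H. 2 * real h)" by (intro order_trans[OF sum_abs] sum_mono shift)
  also have "\<dots> \<le> (real H)\<^sup>2"
    by (induction H) (auto simp: power2_eq_square algebra_simps)
  finally have 1: "real H * \<bar>\<Sum>n<N. F n\<bar> \<le> \<bar>\<Sum>n<N. G n\<bar> + (real H)\<^sup>2"
    using abs_mult[of "real H" "\<Sum>n<N. F n"] by linarith
  have "(\<Sum>n<N. G n)\<^sup>2 \<le> real N * (\<Sum>n<N. (G n)\<^sup>2)"
    using sum_squared_le_card_mult[of G "{..<N}"] by simp
  \<comment> \<open>Squares are nonnegative, so the range may be enlarged from \<open>N\<close> to
    \<open>M\<close>; here the incomplete sum turns into complete ones.\<close>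
  also have "\<dots> \<le> real M * (\<Sum>n<M. (G n)\<^sup>2)"
    using N by (intro mult_mono sum_mono2 sum_nonneg) auto
  also have "(\<Sum>n<M. (G n)\<^sup>2) = (\<Sum>h<H. \<Sum>h'<H. \<Sum>n<M. F (n + h) * F (n + h'))"
  proof -
    have "(\<Sum>n<M. (G n)\<^sup>2) = (\<Sum>n<M. \<Sum>h<H. \<Sum>h'<H. F (n + h) * F (n + h'))"
      by (simp add: G_def power2_eq_square sum_product)
    also have "\<dots> = (\<Sum>h<H. \<Sum>n<M. \<Sum>h'<H. F (n + h) * F (n + h'))" by (rule sum.swap)
    also have "\<dots> = (\<Sum>h<H. \<Sum>h'<H. \<Sum>n<M. F (n + h) * F (n + h'))"
      by (intro sum.cong refl sum.swap)
    finally show ?thesis .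
  qed
  also have "\<dots> \<le> (\<Sum>h<H. \<Sum>h'<H. (if h' = h then real M else 0) + B)"
  proof (intro sum_mono)
    fix h h' assume h: "h \<in> {..<H}" "h' \<in> {..<H}"
    have "F (n + h) * F (n + h) \<le> 1" for n using F[of "n + h"]
      by (metis abs_mult abs_mult_self_eq abs_ge_zero mult_le_one)
    hence "(\<Sum>n<M. F (n + h) * F (n + h)) \<le> (\<Sum>n<M. 1)" by (intro sum_mono)
    thus "(\<Sum>n<M. F (n + h) * F (n + h')) \<le> (if h' = h then real M else 0) + B"
      using corr[of h h'] h B by (auto simp: abs_le_iff)
  qed
  also have "\<dots> = real H * real M + (real H)\<^sup>2 * B"
    by (simp add: sum.distrib power2_eq_square distrib_left)
  finally have "(\<Sum>n<N. G n)\<^sup>2 \<le> real M * (real H * real M + (real H)\<^sup>2 * B)"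
    by (simp add: mult_left_mono)
  hence "\<bar>\<Sum>n<N. G n\<bar> \<le> sqrt (real M * (real H * real M + (real H)\<^sup>2 * B))"
    by (metis real_sqrt_abs real_sqrt_le_mono)
  with 1 show ?thesis by linarith
qed

text \<open>The two symbols combine to one over \<open>2 * card X\<close> forms. Different
  \<open>q\<close> with different shifts may yield proportional forms, so the form to be inverted is
  the one with the largest \<open>v / u\<close> plus shift: it is proportional to no other.\<close>

lemma legendre_sum_shifted_forms:
  fixes u v :: "'i \<Rightarrow> int" and e :: real
  assumes X: "finite X" "X \<noteq> {}"
    and u: "\<And>q. q \<in> X \<Longrightarrow> u q > 0"
    and uv: "\<And>q q'. q \<in> X \<Longrightarrow> q' \<in> X \<Longrightarrow> q \<noteq> q' \<Longrightarrow> u q * v q' \<noteq> u q' * v q"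
    and e: "e > 0" and h: "h \<noteq> (h' :: nat)"
  shows "\<forall>\<^sub>F p in at_top. prime p \<longrightarrow>
    \<bar>real_of_int (\<Sum>n<p. Legendre (\<Prod>q\<in>X. u q * int (n + h) + v q) (int p) *
       Legendre (\<Prod>q\<in>X. u q * int (n + h') + v q) (int p))\<bar> \<le> e * real p"
proof -
  define r where "r q = real_of_int (v q) / real_of_int (u q)" for q
  define q0 where "q0 = (SOME q. q \<in> X \<and> r q = Max (r ` X))"
  have "\<exists>q. q \<in> X \<and> r q = Max (r ` X)"
  proof -
    have "Max (r ` X) \<in> r ` X" using X by (intro Max_in) auto
    thus ?thesis by auto
  qed
  hence q0: "q0 \<in> X" "r q0 = Max (r ` X)"
    unfolding q0_def by (metis (mono_tags, lifting) someI_ex)+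
  have r_le: "r q \<le> r q0" if "q \<in> X" for q using that X q0 by simp
  have r_eq: "q = q0" if "q \<in> X" "r q = r q0" for q
  proof (rule ccontr)
    assume "q \<noteq> q0"
    moreover have "u q0 * v q = u q * v q0"
      using that u[OF that(1)] u[OF q0(1)] unfolding r_def
      by (simp add: field_simps flip: of_int_mult)
    ultimately show False using uv[OF q0(1) that(1)] by simp
  qed
  define h0 where "h0 = max h h'"
  define I where "I = X \<times> {h, h'}"
  define U where "U = (\<lambda>(q, j :: nat). u q)"
  define V where "V = (\<lambda>(q, j). v q + u q * int j)"
  have "\<forall>\<^sub>F p in at_top. prime p \<longrightarrow>
    \<bar>real_of_int (\<Sum>n\<in>{0..<int p}. Legendre (\<Prod>i\<in>I. U i * n + V i) (int p))\<bar> \<le> e * real p"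
  proof (rule legendre_sum_even_forms[of I "(q0, h0)" U V])
    show "finite I" "even (card I)" using X h by (simp_all add: I_def card_cartesian_product)
    show "(q0, h0) \<in> I" using q0 by (simp add: I_def h0_def max_def)
    show "U i \<noteq> 0" if "i \<in> I" for i using that u by (force simp: I_def U_def)
    show "U (q0, h0) * V i - U i * V (q0, h0) \<noteq> 0" if i: "i \<in> I - {(q0, h0)}" for i
    proof -
      obtain q j where qj: "i = (q, j)" "q \<in> X" "j \<le> h0" "q \<noteq> q0 \<or> j < h0"
        using i by (fastforce simp: I_def h0_def)
      have "r q + j < r q0 + h0"
        using r_le[OF qj(2)] r_eq[OF qj(2)] qj(3,4) by fastforce
      hence "real_of_int (u q0) * real_of_int (u q) * (r q + j) <
          real_of_int (u q0) * real_of_int (u q) * (r q0 + h0)"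
        using u[OF q0(1)] u[OF qj(2)] by simp
      moreover have ur: "real_of_int (u q) * r q = v q" if "q \<in> X" for q
        using u[OF that] by (simp add: r_def)
      have "real_of_int (u q0) * real_of_int (u q) * (r q + j) =
          real_of_int (u q0) * (real_of_int (u q) * r q + u q * j)"
        "real_of_int (u q0) * real_of_int (u q) * (r q0 + h0) =
          real_of_int (u q) * (real_of_int (u q0) * r q0 + u q0 * h0)"
        by (simp_all add: algebra_simps)
      ultimately have "real_of_int (U (q0, h0) * V i) < real_of_int (U i * V (q0, h0))"
        by (simp add: U_def V_def qj ur[OF q0(1)] ur[OF qj(2)])
      thus ?thesis by linarith
    qed
  qed (rule e)
  thus ?thesis using eventually_gt_at_top[of 2]
  proof eventually_elim
    case (elim p)
    show ?case
    proof
      assume p: "prime p"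
      have "(\<Sum>n<p. Legendre (\<Prod>q\<in>X. u q * int (n + h) + v q) (int p) *
         Legendre (\<Prod>q\<in>X. u q * int (n + h') + v q) (int p)) =
        (\<Sum>n<p. Legendre (\<Prod>i\<in>I. U i * int n + V i) (int p))"
      proof (intro sum.cong refl)
        fix n
        have "(\<Prod>i\<in>I. U i * int n + V i) = (\<Prod>q\<in>X. \<Prod>j\<in>{h, h'}. u q * int (n + j) + v q)"
          unfolding I_def by (subst prod.cartesian_product) (simp add: U_def V_def case_prod_beta algebra_simps)
        also have "\<dots> = (\<Prod>q\<in>X. u q * int (n + h) + v q) * (\<Prod>q\<in>X. u q * int (n + h') + v q)"
          using h by (simp add: prod.distrib)
        finally show "Legendre (\<Prod>q\<in>X. u q * int (n + h) + v q) (int p) *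
         Legendre (\<Prod>q\<in>X. u q * int (n + h') + v q) (int p) = Legendre (\<Prod>i\<in>I. U i * int n + V i) (int p)"
          by (simp add: Legendre_mult[OF p elim(2)])
      qed
      also have "\<dots> = (\<Sum>n\<in>{0..<int p}. Legendre (\<Prod>i\<in>I. U i * n + V i) (int p))"
        by (rule sum.reindex_bij_witness[where i = nat and j = int]) auto
      finally show "\<bar>real_of_int (\<Sum>n<p. Legendre (\<Prod>q\<in>X. u q * int (n + h) + v q) (int p) *
         Legendre (\<Prod>q\<in>X. u q * int (n + h') + v q) (int p))\<bar> \<le> e * real p"
        using elim(1) p by simp
    qed
  qed
qed

lemma legendre_incomplete_sum:
  fixes u v :: "'i \<Rightarrow> int" and e :: real
  assumes X: "finite X" "X \<noteq> {}"
    and u: "\<And>q. q \<in> X \<Longrightarrow> u q > 0"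
    and uv: "\<And>q q'. q \<in> X \<Longrightarrow> q' \<in> X \<Longrightarrow> q \<noteq> q' \<Longrightarrow> u q * v q' \<noteq> u q' * v q"
    and e: "e > 0"
  shows "\<forall>\<^sub>F p in at_top. prime p \<longrightarrow> (\<forall>N\<le>p.
    \<bar>real_of_int (\<Sum>n<N. Legendre (\<Prod>q\<in>X. u q * int n + v q) (int p))\<bar> \<le> e * real p)"
proof -
  \<comment> \<open>With correlations below \<open>p / H\<close>, the diagonal and the other terms
    contribute \<open>H p\<close> each. \<open>H\<close> makes \<open>sqrt (2 H)\<close> at most
    \<open>H e / 2\<close>, and \<open>P\<close> absorbs the boundary loss
    \<open>H^2\<close>.\<close>
  obtain H :: nat where H: "H > 8 / e\<^sup>2" using reals_Archimedean2 by blast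
  hence "H > 0" using e by (metis gr0I of_nat_0 less_asym divide_pos_pos zero_less_power zero_less_numeral)
  obtain P :: nat where P: "P > 2 * H / e" using reals_Archimedean2 by blast
  have "\<forall>\<^sub>F p in at_top. \<forall>(h, h')\<in>{(h, h'). h < H \<and> h' < H \<and> h \<noteq> h'}. prime p \<longrightarrow>
    \<bar>real_of_int (\<Sum>n<p. Legendre (\<Prod>q\<in>X. u q * int (n + h) + v q) (int p) *
       Legendre (\<Prod>q\<in>X. u q * int (n + h') + v q) (int p))\<bar> \<le> (1 / H) * real p"
  proof (rule eventually_ball_finite)
    show "finite {(h, h'). h < H \<and> h' < H \<and> h \<noteq> h'}"
      by (rule finite_subset[of _ "{..<H} \<times> {..<H}"]) auto
    show "\<forall>hh\<in>{(h, h'). h < H \<and> h' < H \<and> h \<noteq> h'}. \<forall>\<^sub>F p in at_top. case hh of (h, h') \<Rightarrow> prime p \<longrightarrow>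
      \<bar>real_of_int (\<Sum>n<p. Legendre (\<Prod>q\<in>X. u q * int (n + h) + v q) (int p) *
       Legendre (\<Prod>q\<in>X. u q * int (n + h') + v q) (int p))\<bar> \<le> (1 / H) * real p"
    proof
      fix hh assume "hh \<in> {(h, h'). h < H \<and> h' < H \<and> h \<noteq> h'}"
      then obtain h h' where hh: "hh = (h, h')" "h \<noteq> h'" by auto
      show "\<forall>\<^sub>F p in at_top. case hh of (h, h') \<Rightarrow> prime p \<longrightarrow>
        \<bar>real_of_int (\<Sum>n<p. Legendre (\<Prod>q\<in>X. u q * int (n + h) + v q) (int p) *
         Legendre (\<Prod>q\<in>X. u q * int (n + h') + v q) (int p))\<bar> \<le> (1 / H) * real p"
        unfolding hh(1) prod.case
        by (rule legendre_sum_shifted_forms[OF X u uv]) (use \<open>H > 0\<close> hh(2) in auto)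
    qed
  qed
  thus ?thesis using eventually_ge_at_top[of P]
  proof eventually_elim
    case (elim p)
    show ?case
    proof (intro impI allI)
      fix N assume p: "prime p" and N: "N \<le> p"
      define F where "F n = real_of_int (Legendre (\<Prod>q\<in>X. u q * int n + v q) (int p))" for n
      have "real H * \<bar>\<Sum>n<N. F n\<bar> \<le>
        sqrt (real p * (real H * real p + (real H)\<^sup>2 * (1 / H * real p))) + (real H)\<^sup>2"
      proof (rule van_der_corput_shift[OF _ \<open>H > 0\<close> N])
        show "\<bar>F n\<bar> \<le> 1" for n
          using Legendre_cases[of "\<Prod>q\<in>X. u q * int n + v q" "int p"] by (auto simp: F_def)
        show "\<bar>\<Sum>n<p. F (n + h) * F (n + h')\<bar> \<le> 1 / H * real p"
          if "h < H" "h' < H" "h \<noteq> h'" for h h'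
          using elim(1) p that unfolding F_def by (fastforce simp flip: of_int_mult of_int_sum)
      qed auto
      also have "real p * (real H * real p + (real H)\<^sup>2 * (1 / H * real p)) = 2 * H * (real p)\<^sup>2"
        using \<open>H > 0\<close> by (simp add: power2_eq_square field_simps)
      also have "sqrt (2 * H * (real p)\<^sup>2) \<le> sqrt ((real H * (e / 2 * p))\<^sup>2)"
      proof -
        have "8 \<le> e\<^sup>2 * H" using H e by (simp add: field_simps)
        hence "8 * (H * (real p)\<^sup>2) \<le> (e\<^sup>2 * H) * (H * (real p)\<^sup>2)"
          by (intro mult_right_mono) auto
        thus ?thesis by (intro real_sqrt_le_mono) (simp add: power2_eq_square algebra_simps)
      qed
      also have "\<dots> = real H * (e / 2 * p)" using e by simp
      also have "real H * (e / 2 * p) + (real H)\<^sup>2 \<le> real H * (e * p)"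
      proof -
        have "2 * H \<le> e * P" using P e by (simp add: field_simps)
        also have "\<dots> \<le> e * p" using elim(2) e by simp
        finally have "real H * real H \<le> real H * (e / 2 * p)" by (intro mult_left_mono) auto
        thus ?thesis by (simp add: power2_eq_square)
      qed
      finally have "\<bar>\<Sum>n<N. F n\<bar> \<le> e * p" using \<open>H > 0\<close> by simp
      thus "\<bar>real_of_int (\<Sum>n<N. Legendre (\<Prod>q\<in>X. u q * int n + v q) (int p))\<bar> \<le> e * real p"
        by (simp add: F_def)
    qed
  qed
qed

section \<open>Primes congruent to 1\<close>

text \<open>Factorization takes place over the integers, where values can be reduced modulo primes,
  whereas the root of unity is complex.\<close>

definition eval_complex :: "int poly \<Rightarrow> complex \<Rightarrow> complex" where
  "eval_complex f z = poly (map_poly of_int f) z"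

lemma eval_complex_mult: "eval_complex (f * g) z = eval_complex f z * eval_complex g z"
proof -
  have "map_poly (of_int :: int \<Rightarrow> complex) (f * g) = map_poly of_int f * map_poly of_int g"
    by (rule poly_eqI) (simp add: coeff_map_poly coeff_mult)
  thus ?thesis by (simp add: eval_complex_def)
qed

lemma eval_complex_const [simp]: "eval_complex [:c:] z = of_int c"
  by (simp add: eval_complex_def map_poly_pCons)

lemma eval_complex_power_minus_1: "eval_complex (monom 1 n - 1) z = z ^ n - 1"
proof -
  have "map_poly (of_int :: int \<Rightarrow> complex) (monom 1 n - 1) = monom 1 n - 1"
    by (rule poly_eqI) (auto simp: coeff_map_poly)
  thus ?thesis by (simp add: eval_complex_def poly_monom)
qed

text \<open>If a product vanishes at \<open>z\<close>, so does one of its factors, while units never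
  vanish.\<close>

lemma prime_factor_vanishing:
  assumes "f \<noteq> 0" "eval_complex f z = 0"
  obtains F where "prime F" "F dvd f" "eval_complex F z = 0"
proof -
  have "f \<noteq> 0 \<longrightarrow> eval_complex f z = 0 \<longrightarrow> (\<exists>F. prime F \<and> F dvd f \<and> eval_complex F z = 0)"
  proof (induction f rule: prime_divisors_induct)
    case (unit f)
    then obtain g where "1 = f * g" by (rule dvdE)
    hence "eval_complex 1 z = eval_complex f z * eval_complex g z" by (metis eval_complex_mult)
    thus ?case by (auto simp: eval_complex_def)
  next
    case (factor F f)
    show ?case
    proof (intro impI)
      assume "F * f \<noteq> 0" "eval_complex (F * f) z = 0"
      hence "eval_complex F z = 0 \<or> eval_complex f z = 0 \<and> f \<noteq> 0" by (auto simp: eval_complex_mult)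
      thus "\<exists>F'. prime F' \<and> F' dvd F * f \<and> eval_complex F' z = 0"
        using factor by (metis dvd_mult dvd_triv_left)
    qed
  qed simp
  thus thesis using assms that by blast
qed

lemma cis_power_neq_1:
  assumes "0 < d" "d < M"
  shows "cis (2 * pi / real M) ^ d \<noteq> 1"
proof
  assume "cis (2 * pi / real M) ^ d = 1"
  hence "cos (real d * (2 * pi / real M)) = 1" by (simp add: DeMoivre complex_eq_iff)
  then obtain n :: int where "real d * (2 * pi / real M) = real_of_int n * 2 * pi"
    unfolding cos_one_2pi_int by blast
  hence "real d = n * real M" using assms by (simp add: field_simps)
  hence "int d = n * int M" by (metis of_int_eq_iff of_int_mult of_int_of_nat_eq)
  thus False using assms by (metis dvd_triv_right int_dvd_int_iff nat_dvd_not_less)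
qed

text \<open>An irreducible factor \<open>F\<close> of \<open>X ^ M - 1\<close> over the integers that vanishes at a primitive
  \<open>M\<close>-th root of unity divides \<open>(X ^ M - 1) / (X ^ d - 1)\<close> for all proper divisors \<open>d\<close> of \<open>M\<close>.
  Hence \<open>M t\<close> has order exactly \<open>M\<close> modulo every prime divisor of \<open>F (M t)\<close>.\<close>

lemma exists_prime_cong_1:
  fixes M :: nat
  assumes "M > 1"
  obtains p where "prime p" "[p = 1] (mod M)"
proof -
  define z where "z = cis (2 * pi / real M)"
  have XM: "monom 1 M - 1 \<noteq> (0 :: int poly)"
  proof
    assume "monom 1 M - 1 = (0 :: int poly)"
    hence "coeff (monom 1 M - 1 :: int poly) M = 0" by simp
    thus False using assms by simp
  qed
  have "z ^ M = 1" using assms by (simp add: z_def DeMoivre)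
  then obtain F where F: "prime F" "F dvd monom 1 M - 1" "eval_complex F z = 0"
    using prime_factor_vanishing[OF XM, of z] by (auto simp: eval_complex_power_minus_1)
  have deg: "degree F \<noteq> 0"
  proof
    assume "degree F = 0"
    then obtain c where c: "F = [:c:]" by (rule degree_eq_zeroE)
    with F(3) have "c = 0" by simp
    with c F(1) show False by simp
  qed
  have geometric: "monom 1 M - 1 = (monom 1 d - 1) * (\<Sum>i<M div d. monom 1 (d * i) :: int poly)"
    if "d dvd M" for d
  proof -
    have "monom (1::int) M = monom 1 d ^ (M div d)" using that by (simp add: monom_power)
    hence "monom 1 M - 1 = (monom 1 d - 1) * (\<Sum>i<M div d. monom (1::int) d ^ i)"
      by (simp only: power_diff_1_eq)
    thus ?thesis by (simp add: monom_power)
  qed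
  have cofactor: "F dvd (\<Sum>i<M div d. monom 1 (d * i))" if d: "d dvd M" "d < M" for d
  proof -
    have "d > 0" using d assms by (metis dvd_0_left_iff gr0I not_less_zero)
    have "\<not> F dvd monom 1 d - 1"
    proof
      assume "F dvd monom 1 d - 1"
      then obtain g where "monom 1 d - 1 = F * g" by (rule dvdE)
      hence "z ^ d - 1 = 0" using F(3) by (metis eval_complex_mult eval_complex_power_minus_1 mult_zero_left)
      thus False using cis_power_neq_1[OF \<open>d > 0\<close> d(2)] by (simp add: z_def)
    qed
    thus ?thesis using F(1,2) geometric[OF d(1)] by (simp add: prime_dvd_mult_iff)
  qed
  \<comment> \<open>The nonconstant \<open>F\<close> takes the values 1 and -1 only finitely often,
    so at some multiple of \<open>M\<close> its value has a prime divisor.\<close>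
  have roots: "finite {x. poly (F - [:c:]) x = 0}" for c
  proof (rule poly_roots_finite)
    show "F - [:c:] \<noteq> 0" using deg by (metis degree_pCons_0 eq_iff_diff_eq_0)
  qed
  have "finite ({x. poly (F - [:1:]) x = 0} \<union> {x. poly (F - [:-1:]) x = 0})"
    by (intro finite_UnI roots)
  moreover have "infinite (range (\<lambda>t. int M * int t))"
    using assms by (intro range_inj_infinite) (auto simp: inj_def)
  ultimately have "\<not> range (\<lambda>t. int M * int t) \<subseteq>
      {x. poly (F - [:1:]) x = 0} \<union> {x. poly (F - [:-1:]) x = 0}"
    using finite_subset by blast
  then obtain t where t: "poly F (int M * int t) \<noteq> 1" "poly F (int M * int t) \<noteq> -1"
    by (auto simp: eq_neg_iff_add_eq_0)
  define n where "n = M * t"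
  have "\<bar>poly F (int n)\<bar> \<noteq> 1" using t by (auto simp: n_def abs_if)
  then obtain q where q: "prime q" "q dvd poly F (int n)" using prime_factor_int[of "poly F (int n)"] by auto
  obtain p where "q = int p" using prime_ge_0_int[OF q(1)] by (rule nonneg_int_cases)
  hence p: "prime p" "int p dvd poly F (int n)" using q by simp_all
  have eval_dvd: "int p dvd poly f (int n)" if "F dvd f" for f
    using that p(2) by (auto elim!: dvdE)
  have nM: "int p dvd int n ^ M - 1" using eval_dvd[OF F(2)] by (simp add: poly_monom)
  \<comment> \<open>Evaluating at a multiple of \<open>M\<close> pays off here: a common prime
    divisor would divide both \<open>n ^ M\<close> and \<open>n ^ M - 1\<close>.\<close>
  have pM: "\<not> p dvd M"
  proof
    assume "p dvd M"
    hence "int p dvd int n" by (simp add: n_def)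
    hence "int p dvd int n ^ M" using assms by (meson dvd_power dvd_trans less_trans zero_less_one)
    hence "int p dvd int n ^ M - (int n ^ M - 1)" using nM by (rule dvd_diff)
    thus False using p(1) by (simp add: prime_nat_iff)
  qed
  have "ord p n = M"
  proof (rule ccontr)
    define d where "d = ord p n"
    assume neq: "ord p n \<noteq> M"
    have "[int n ^ M = 1] (mod int p)" using nM by (simp add: cong_iff_dvd_diff)
    hence "[n ^ M = 1] (mod p)" by (metis cong_int_iff of_nat_1 of_nat_power)
    hence d: "d dvd M" "d < M" using neq assms unfolding d_def ord_divides
      by (auto dest!: dvd_imp_le)
    have "[n ^ d = 1] (mod p)" unfolding d_def by (rule ord)
    hence nd: "[int n ^ d = 1] (mod int p)" by (metis cong_int_iff of_nat_1 of_nat_power)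
    \<comment> \<open>Modulo \<open>p\<close> every term of the cofactor is 1, so its value is
      \<open>M div d\<close>; as \<open>F\<close> divides the cofactor, this would be divisible by
      \<open>p\<close>.\<close>
    have "(\<Sum>i<M div d. (int n ^ d) ^ i) = poly (\<Sum>i<M div d. monom 1 (d * i)) (int n)"
      by (simp add: poly_sum poly_monom power_mult)
    hence "[(\<Sum>i<M div d. (int n ^ d) ^ i) = 0] (mod int p)"
      using eval_dvd[OF cofactor[OF d]] by (simp add: cong_0_iff)
    moreover have "[(\<Sum>i<M div d. (int n ^ d) ^ i) = (\<Sum>i<M div d. 1 ^ i)] (mod int p)"
      by (intro cong_sum cong_pow nd)
    ultimately have "[int (M div d) = 0] (mod int p)" by (simp add: cong_def)
    hence "p dvd M div d" by (simp add: cong_0_iff)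
    thus False using pM d(1) by (metis dvd_div_mult_self dvd_mult2)
  qed
  moreover have "[n ^ (p - 1) = 1] (mod p)"
  proof (rule fermat_theorem[OF p(1)])
    show "\<not> p dvd n"
    proof
      assume "p dvd n"
      hence "int p dvd int n ^ M" using assms by (meson dvd_power dvd_trans int_dvd_int_iff less_trans zero_less_one)
      hence "int p dvd int n ^ M - (int n ^ M - 1)" using nM by (rule dvd_diff)
      thus False using p(1) by (simp add: prime_nat_iff)
    qed
  qed
  ultimately have "M dvd p - 1" using ord_divides by metis
  hence "[p = 1] (mod M)" using p(1) prime_ge_1_nat by (metis cong_altdef_nat)
  thus thesis using that p(1) by blast
qed

section \<open>Quadratic characters at primes congruent to 1 modulo 4\<close>

text \<open>Gauss's lemma: among the doubles of \<open>1, ..., 2 r\<close>, exactly those of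
  \<open>r + 1, ..., 2 r\<close> exceed \<open>(p - 1) / 2\<close>.\<close>

lemma Legendre_2_aux:
  assumes "prime p" "p = 4 * r + 1"
  shows "Legendre 2 (int p) = (-1) ^ r"
proof -
  have "p > 2" using assms prime_ge_2_nat[OF assms(1)] by presburger
  interpret GAUSS p 2
    by unfold_locales (use assms \<open>p > 2\<close> in \<open>auto simp: cong_0_iff dest: zdvd_imp_le\<close>)
  have half: "(int p - 1) div 2 = 2 * int r" using assms by simp
  have "E = (\<lambda>x. x * 2) ` {int r <.. 2 * int r}"
  proof -
    have "C = (\<lambda>x. x * 2) ` A"
      unfolding C_def B_def image_image
    proof (intro image_cong refl mod_pos_pos_trivial)
      fix x assume "x \<in> A"
      hence "0 < x" "x \<le> 2 * int r" by (auto simp: A_def half)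
      thus "0 \<le> x * 2" "x * 2 < int p" using assms(2) by auto
    qed
    thus ?thesis unfolding E_def half by (auto simp: A_def half)
  qed
  hence "card E = r" by (simp add: card_image inj_on_def)
  thus ?thesis using gauss_lemma by simp
qed

text \<open>The symbol of \<open>q\<close> modulo a prime \<open>n\<close> that is 1 modulo 4, after
  reciprocity. In this form it makes sense for composite \<open>n\<close>; for \<open>q = 2\<close>
  it tells 1 from 5 modulo 8.\<close>

definition reciprocal_character :: "nat \<Rightarrow> nat \<Rightarrow> int" where
  "reciprocal_character q n =
     (if q = 2 then (if n mod 8 = 1 then 1 else - 1) else Legendre (int n) (int q))"

lemma Legendre_prime_eq_reciprocal:
  assumes "prime p" "p mod 4 = 1" "prime q" "q \<noteq> p"
  shows "Legendre (int q) (int p) = reciprocal_character q p"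
proof (cases "q = 2")
  case True
  obtain r where r: "p = 4 * r + 1" using assms(2) by (metis mult_div_mod_eq)
  have "even r \<longleftrightarrow> p mod 8 = 1" using r by presburger
  thus ?thesis using Legendre_2_aux[OF assms(1) r] True by (auto simp: reciprocal_character_def)
next
  case False
  have "p > 2" "q > 2" using assms False prime_ge_2_nat[of p] prime_ge_2_nat[of q] by (auto intro: le_neq_implies_less)
  have "even ((p - 1) div 2)" using assms(2) by presburger
  hence 1: "Legendre (int p) (int q) * Legendre (int q) (int p) = 1"
    using Quadratic_Reciprocity[OF assms(1) \<open>p > 2\<close> assms(3) \<open>q > 2\<close>] assms(4) by simp
  have "Legendre (int q) (int p) = Legendre (int p) (int q)"
    using 1 Legendre_cases[of "int p" "int q"] Legendre_cases[of "int q" "int p"] by auto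
  thus ?thesis using False by (simp add: reciprocal_character_def)
qed

text \<open>The prime factors of the squarefree part of a positive \<open>D\<close>; there are none
  exactly if \<open>D\<close> is a square.\<close>

definition odd_part_primes :: "nat \<Rightarrow> nat set" where
  "odd_part_primes D = {q. prime q \<and> odd (multiplicity q D)}"

lemma odd_part_primes_subset: "odd_part_primes D \<subseteq> prime_factors D"
  by (auto simp: odd_part_primes_def prime_factors_multiplicity intro: gr0I)

text \<open>Squares drop out, and reciprocity turns the symbol modulo \<open>p\<close> into an
  expression that can be evaluated at any number and factored there.\<close>

lemma Legendre_eq_prod_reciprocal:
  assumes p: "prime p" "p mod 4 = 1" and D: "D > 0" "\<not> p dvd D"
  shows "Legendre (int D) (int p) = (\<Prod>q\<in>odd_part_primes D. reciprocal_character q p)"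
proof -
  let ?L = "\<lambda>q. Legendre (int q) (int p)"
  have p2: "p > 2" using p(2) prime_ge_2_nat[OF p(1)] by presburger
  have neq: "q \<noteq> p" "\<not> int p dvd int q" if "q \<in> prime_factors D" for q
    using that p D by (auto simp: in_prime_factors_iff primes_dvd_imp_eq)
  have "?L D = ?L (\<Prod>q\<in>prime_factors D. q ^ multiplicity q D)"
    using prime_factorization_nat[OF D(1)] by simp
  also have "\<dots> = (\<Prod>q\<in>prime_factors D. ?L q ^ multiplicity q D)"
  proof -
    have "Legendre (a ^ n) (int p) = Legendre a (int p) ^ n" for a n
      by (induction n) (use p2 in \<open>simp_all add: Legendre_1 Legendre_mult[OF p(1) p2]\<close>)
    thus ?thesis by (simp add: Legendre_prod[OF p(1) p2])
  qed
  also have "\<dots> = (\<Prod>q\<in>prime_factors D. if odd (multiplicity q D) then ?L q else 1)"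
  proof (intro prod.cong refl)
    fix q assume "q \<in> prime_factors D"
    hence "?L q = 1 \<or> ?L q = -1"
      using neq(2) Legendre_cases[of "int q" "int p"] by (auto simp: Legendre_eq_0_iff)
    thus "?L q ^ multiplicity q D = (if odd (multiplicity q D) then ?L q else 1)" by auto
  qed
  also have "\<dots> = (\<Prod>q\<in>odd_part_primes D. if odd (multiplicity q D) then ?L q else 1)"
  proof (rule prod.mono_neutral_right)
    show "\<forall>q\<in>prime_factors D - odd_part_primes D. (if odd (multiplicity q D) then ?L q else 1) = 1"
      by (auto simp: odd_part_primes_def in_prime_factors_imp_prime)
  qed (use odd_part_primes_subset in auto)
  also have "\<dots> = (\<Prod>q\<in>odd_part_primes D. reciprocal_character q p)"
  proof (intro prod.cong refl)
    fix q assume q: "q \<in> odd_part_primes D"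
    have "q \<noteq> p" using neq(1) q odd_part_primes_subset by blast
    thus "(if odd (multiplicity q D) then ?L q else 1) = reciprocal_character q p"
      using q Legendre_prime_eq_reciprocal[OF p] by (simp add: odd_part_primes_def)
  qed
  finally show ?thesis .
qed

lemma infinite_primes_all_residues:
  fixes m :: nat
  assumes "m > 0"
  shows "infinite {p. prime p \<and> p > 2 \<and> (\<forall>D. D dvd m \<longrightarrow> Legendre (int D) (int p) = 1)}"
  unfolding infinite_nat_iff_unbounded
proof
  fix K :: nat
  have "m * fact (K + 2) \<ge> 1" using assms by (simp add: Suc_le_eq)
  hence "8 * m * fact (K + 2) > 1" by linarith
  \<comment> \<open>In the modulus, 8 serves the prime 2 and the residue modulo 4, \<open>m\<close>
    serves its own prime factors, and the factorial forces \<open>p\<close> to be large.\<close>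
  then obtain p where p: "prime p" "[p = 1] (mod (8 * m * fact (K + 2)))"
    using exists_prime_cong_1 by blast
  have big: "r > K + 2" if "r dvd p" "prime r" for r
  proof (rule ccontr)
    assume "\<not> r > K + 2"
    hence "r dvd fact (K + 2)" using prime_dvd_fact_iff[OF that(2), of "K + 2"] by linarith
    hence "r dvd 8 * m * fact (K + 2)" by simp
    hence "[p = 1] (mod r)" using p(2) cong_dvd_modulus_nat by blast
    hence "[1 = 0] (mod r)" using that(1) by (metis cong_0_iff cong_sym cong_trans)
    thus False using that(2) by (simp add: cong_0_iff)
  qed
  have pK: "p > K + 2" using big p(1) by simp
  have "Legendre (int D) (int p) = 1" if "D dvd m" for D
  proof -
    have "[p = 1] (mod 8 * D)"
      using p(2) that by (meson cong_dvd_modulus_nat dvd_mult2 mult_dvd_mono dvd_refl)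
    have D0: "D > 0" using that assms by (auto intro: gr0I)
    have p1: "[p = 1] (mod q)" if "q dvd 8 * D" for q
      using \<open>[p = 1] (mod 8 * D)\<close> that cong_dvd_modulus_nat by blast
    have "p mod 4 = 1" using p1[of 4] by (simp add: cong_def)
    have "p mod 8 = 1" using p1[of 8] by (simp add: cong_def)
    have nd: "\<not> p dvd D"
    proof
      assume "p dvd D"
      hence "[p = 1] (mod p)" using p1 by simp
      thus False using p(1) prime_gt_1_nat[OF p(1)] by (simp add: cong_def)
    qed
    have "reciprocal_character q p = 1" if "q \<in> odd_part_primes D" for q
    proof -
      have "q dvd D" "prime q" using that odd_part_primes_subset by (auto simp: in_prime_factors_iff)
      hence "[int p = int 1] (mod int q)" using p1[of q] by (simp only: cong_int_iff) simp
      hence "Legendre (int p) (int q) = Legendre 1 (int q)" using Legendre_cong by simp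
      thus ?thesis using \<open>p mod 8 = 1\<close> Legendre_1[of q] prime_gt_1_nat[OF \<open>prime q\<close>]
        by (simp add: reciprocal_character_def)
    qed
    thus ?thesis using Legendre_eq_prod_reciprocal[OF p(1) \<open>p mod 4 = 1\<close> D0 nd] by simp
  qed
  thus "\<exists>p>K. p \<in> {p. prime p \<and> p > 2 \<and> (\<forall>D. D dvd m \<longrightarrow> Legendre (int D) (int p) = 1)}"
    using p(1) pK by (intro exI[of _ p]) auto
qed

section \<open>Primes at which a nonsquare is a nonresidue\<close>

text \<open>Otherwise adding 1 to a square would always give a square modulo \<open>q\<close>.
  Starting from 0, every residue would be a square, although squaring identifies 1 and -1.\<close>

lemma exists_square_plus_1_nonresidue:
  assumes "prime q" "q > 2"
  obtains w where "Legendre (w\<^sup>2 + 1) (int q) = -1"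
proof (rule ccontr)
  assume none: "\<not> thesis"
  have succ: "\<exists>y. [y\<^sup>2 = w\<^sup>2 + 1] (mod int q)" for w
  proof -
    have "Legendre (w\<^sup>2 + 1) (int q) \<noteq> -1" using none that by blast
    thus ?thesis
      by (auto simp: Legendre_def QuadRes_def cong_sym_eq intro: exI[of _ 0] split: if_splits)
  qed
  have sq: "\<exists>y. [y\<^sup>2 = int n] (mod int q)" for n
  proof (induction n)
    case 0
    show ?case by (rule exI[of _ 0]) simp
  next
    case (Suc n)
    then obtain y where "[y\<^sup>2 = int n] (mod int q)" by blast
    hence "[y\<^sup>2 + 1 = int (Suc n)] (mod int q)" using cong_add_rcancel[of "y\<^sup>2" 1 "int n"] by (simp add: add.commute)
    thus ?case using succ[of y] cong_trans by blast
  qed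
  define sqr where "sqr y = y\<^sup>2 mod int q" for y
  have q: "int q > 2" using assms by simp
  have "{0..<int q} \<subseteq> sqr ` {0..<int q}"
  proof
    fix a assume a: "a \<in> {0..<int q}"
    obtain y where "[y\<^sup>2 = a] (mod int q)" using sq[of "nat a"] a by auto
    hence "sqr (y mod int q) = a" using a by (simp add: sqr_def cong_def power_mod)
    thus "a \<in> sqr ` {0..<int q}" using q by force
  qed
  moreover have "sqr ` {0..<int q} \<subseteq> {0..<int q}" using q by (auto simp: sqr_def)
  ultimately have "sqr ` {0..<int q} = {0..<int q}" by blast
  hence "inj_on sqr {0..<int q}" by (intro eq_card_imp_inj_on) auto
  moreover have "sqr 1 = sqr (int q - 1)"
  proof -
    have "(int q - 1)\<^sup>2 = 1 + int q * (int q - 2)" by (simp add: power2_eq_square algebra_simps)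
    thus ?thesis by (simp add: sqr_def)
  qed
  ultimately have "1 = int q - 1" using q by (auto dest!: inj_onD)
  thus False using q by simp
qed

lemma prime_dvd_square_plus_1:
  fixes p x :: nat
  assumes "prime p" "p > 2" "p dvd x\<^sup>2 + 1"
  shows "p mod 4 = 1"
proof -
  have "int p dvd int (x\<^sup>2 + 1)" using assms(3) by (simp only: of_nat_dvd_iff)
  hence "[(int x)\<^sup>2 = -1] (mod int p)" by (simp add: cong_iff_dvd_diff algebra_simps)
  hence "QuadRes (int p) (-1)" by (auto simp: QuadRes_def)
  moreover have "\<not> [-1 = 0] (mod int p)" using assms(2) by (auto simp: cong_0_iff)
  ultimately have "Legendre (-1) (int p) = 1" by (simp add: Legendre_def)
  hence "[1 = (-1) ^ ((p - 1) div 2)] (mod int p)"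
    using euler_criterion[OF assms(1,2), of "-1"] by simp
  hence "1 = (-1 :: int) ^ ((p - 1) div 2)"
    by (rule Legendre_eqI[rotated 2]) (use assms(2) in \<open>auto simp: minus_one_power_iff\<close>)
  hence "even ((p - 1) div 2)" by (simp add: minus_one_power_iff split: if_splits)
  moreover have "odd p" using prime_odd_nat assms by blast
  ultimately show ?thesis by presburger
qed

text \<open>For \<open>q = 2\<close> this rests on \<open>5 * 5\<close> being 1 modulo 8; residues 3
  and 7 would spoil it.\<close>

lemma reciprocal_character_mult:
  assumes "prime q" "a mod 4 = 1" "b mod 4 = 1"
  shows "reciprocal_character q (a * b) = reciprocal_character q a * reciprocal_character q b"
proof (cases "q = 2")
  case True
  have "a mod 8 = 1 \<or> a mod 8 = 5" "b mod 8 = 1 \<or> b mod 8 = 5" using assms by presburger+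
  moreover have "(a * b) mod 8 = (a mod 8) * (b mod 8) mod 8" by (simp add: mod_mult_eq)
  ultimately show ?thesis using True by (auto simp: reciprocal_character_def)
next
  case False
  hence "q > 2" using assms prime_ge_2_nat[of q] by linarith
  thus ?thesis using False by (simp add: reciprocal_character_def Legendre_mult[OF assms(1)])
qed

text \<open>If all prime factors had value 1, so would \<open>N\<close> by multiplicativity. The
  residue modulo 4 is carried through the induction because multiplicativity depends on it.\<close>

lemma exists_prime_divisor_reciprocal_neq_1:
  assumes "N > 0" "\<And>q. q \<in> Q \<Longrightarrow> prime q" "\<And>p. prime p \<Longrightarrow> p dvd N \<Longrightarrow> p mod 4 = 1"
    and "(\<Prod>q\<in>Q. reciprocal_character q N) \<noteq> 1"
  obtains p where "prime p" "p dvd N" "(\<Prod>q\<in>Q. reciprocal_character q p) \<noteq> 1"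
proof -
  have "N > 0 \<longrightarrow> (\<forall>p. prime p \<longrightarrow> p dvd N \<longrightarrow> p mod 4 = 1 \<and> (\<Prod>q\<in>Q. reciprocal_character q p) = 1) \<longrightarrow>
    N mod 4 = 1 \<and> (\<Prod>q\<in>Q. reciprocal_character q N) = 1" for N
  proof (induction N rule: prime_divisors_induct)
    case (unit N)
    have "reciprocal_character q 1 = 1" if "q \<in> Q" for q
      using assms(2)[OF that] prime_gt_1_nat[of q] by (simp add: reciprocal_character_def Legendre_1)
    thus ?case using unit by simp
  next
    case (factor p N)
    show ?case
    proof (intro impI)
      assume "p * N > 0" and all: "\<forall>r. prime r \<longrightarrow> r dvd p * N \<longrightarrow>
        r mod 4 = 1 \<and> (\<Prod>q\<in>Q. reciprocal_character q r) = 1"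
      hence p: "p mod 4 = 1" "(\<Prod>q\<in>Q. reciprocal_character q p) = 1" using factor(1) by auto
      have N: "N mod 4 = 1" "(\<Prod>q\<in>Q. reciprocal_character q N) = 1"
        using factor(2) all \<open>p * N > 0\<close> by auto
      have "(p * N) mod 4 = (p mod 4) * (N mod 4) mod 4" by (simp add: mod_mult_eq)
      moreover have "(\<Prod>q\<in>Q. reciprocal_character q (p * N)) =
          (\<Prod>q\<in>Q. reciprocal_character q p * reciprocal_character q N)"
        by (intro prod.cong refl reciprocal_character_mult assms(2) p N)
      ultimately show "(p * N) mod 4 = 1 \<and> (\<Prod>q\<in>Q. reciprocal_character q (p * N)) = 1"
        by (simp add: prod.distrib p N)
    qed
  qed simp
  thus thesis using assms that by blast
qed

text \<open>\<open>x\<close> is a multiple of \<open>2 m\<close>, where \<open>m\<close> collects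
  the small primes other than \<open>q1\<close>. For \<open>q1 = 2\<close> the choice
  \<open>2 m\<close> with \<open>m\<close> odd gives 5 modulo 8; for odd \<open>q1\<close> the
  number \<open>2 m\<close> is invertible, so a multiple of it hits any prescribed residue.\<close>

lemma exists_square_plus_1_character:
  assumes "prime q1"
  obtains x where "even x" "q1 \<noteq> 2 \<Longrightarrow> 4 dvd x" "\<And>r. prime r \<Longrightarrow> r \<le> K \<Longrightarrow> r \<noteq> q1 \<Longrightarrow> r dvd x"
    "reciprocal_character q1 (x\<^sup>2 + 1) = -1"
proof -
  \<comment> \<open>The bound \<open>max 2 K\<close> ensures that 2 is a factor of \<open>m\<close>
    whenever \<open>q1\<close> is odd, so that 4 divides \<open>2 * m\<close>.\<close>
  define m where "m = (\<Prod>r\<in>{r. prime r \<and> r \<le> max 2 K \<and> r \<noteq> q1}. r)"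
  have fin: "finite {r. prime r \<and> r \<le> max 2 K \<and> r \<noteq> q1}"
    by (rule finite_subset[of _ "{..max 2 K}"]) auto
  have m: "r dvd m" if "prime r" "r \<le> max 2 K" "r \<noteq> q1" for r
    unfolding m_def by (rule dvd_prodI[OF fin]) (use that in auto)
  have q1m: "\<not> q1 dvd m"
  proof
    assume "q1 dvd m"
    then obtain r where "prime r" "r \<noteq> q1" "q1 dvd r"
      using assms fin unfolding m_def by (auto simp: prime_dvd_prod_iff)
    thus False using assms primes_dvd_imp_eq by blast
  qed
  show thesis
  proof (cases "q1 = 2")
    case True
    show thesis
    proof (rule that[of "2 * m"])
      have "odd m" using q1m True by simp
      then obtain j where "m = 2 * j + 1" by (rule oddE)
      hence "(2 * m)\<^sup>2 + 1 = 8 * (2 * j\<^sup>2 + 2 * j) + 5" by (simp add: power2_eq_square algebra_simps)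
      hence "((2 * m)\<^sup>2 + 1) mod 8 = 5" by (simp only: mod_mult_self4) simp
      thus "reciprocal_character q1 ((2 * m)\<^sup>2 + 1) = -1" using True by (simp add: reciprocal_character_def)
    qed (use m True in auto)
  next
    case False
    hence "q1 > 2" using assms prime_ge_2_nat[of q1] by linarith
    obtain w where w: "Legendre (w\<^sup>2 + 1) (int q1) = -1"
      using exists_square_plus_1_nonresidue[OF assms \<open>q1 > 2\<close>] .
    have "\<not> q1 dvd 2 * m" using q1m assms \<open>q1 > 2\<close> by (auto simp: prime_dvd_mult_iff dest: dvd_imp_le)
    hence "\<not> int q1 dvd int (2 * m)" by (simp only: of_nat_dvd_iff not_False_eq_True)
    then obtain y where y: "[int (2 * m) * y = 1] (mod int q1)"
      using modular_inverse_exists[OF assms] by blast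
    define t where "t = nat ((y * w) mod int q1)"
    have "[int t = y * w] (mod int q1)" using assms prime_gt_0_nat[OF assms] by (simp add: t_def)
    hence "[int (2 * m) * int t = int (2 * m) * (y * w)] (mod int q1)" by (rule cong_scalar_left)
    also have "int (2 * m) * (y * w) = (int (2 * m) * y) * w" by simp
    also have "[\<dots> = 1 * w] (mod int q1)" using y by (rule cong_scalar_right)
    finally have "[int (2 * m * t) = w] (mod int q1)" by simp
    hence "[int (2 * m * t) ^ 2 + 1 = w\<^sup>2 + 1] (mod int q1)" by (intro cong_add cong_pow cong_refl)
    hence "Legendre (int (2 * m * t) ^ 2 + 1) (int q1) = -1" using w Legendre_cong by simp
    moreover have "int (2 * m * t) ^ 2 + 1 = int ((2 * m * t)\<^sup>2 + 1)" by simp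
    ultimately have "Legendre (int ((2 * m * t)\<^sup>2 + 1)) (int q1) = -1" by (simp only:)
    moreover have "2 dvd m" using m[of 2] False by simp
    ultimately show thesis using that[of "2 * m * t"] m False
      by (auto simp: reciprocal_character_def dvd_mult2 elim!: dvdE)
  qed
qed

text \<open>\<open>N = x^2 + 1\<close> gets the value -1 at one prime \<open>q1\<close> of the
  squarefree part and 1 at all others, so the total character is -1. All prime factors of
  \<open>N\<close> exceed \<open>K\<close>, and one of them inherits a value different from
  1.\<close>

lemma infinite_primes_nonresidue:
  fixes D :: nat
  assumes "D > 0" "\<not> is_square D"
  shows "infinite {p. prime p \<and> p > 2 \<and> Legendre (int D) (int p) = -1}"
  unfolding infinite_nat_iff_unbounded
proof
  fix K0 :: nat
  define K where "K = max K0 (max 2 D)"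
  define Q where "Q = odd_part_primes D"
  have "finite Q" unfolding Q_def using odd_part_primes_subset finite_subset by blast
  have Q: "prime q" "q \<le> K" if "q \<in> Q" for q
  proof -
    have "prime q" "q dvd D" using that odd_part_primes_subset by (auto simp: Q_def in_prime_factors_iff)
    thus "prime q" "q \<le> K" using assms(1) by (auto simp: K_def dest: dvd_imp_le)
  qed
  obtain q1 where q1: "q1 \<in> Q"
    using assms(2) by (auto simp: Q_def odd_part_primes_def is_nth_power_conv_multiplicity_nat)
  obtain x where x: "even x" "q1 \<noteq> 2 \<Longrightarrow> 4 dvd x" "\<And>r. prime r \<Longrightarrow> r \<le> K \<Longrightarrow> r \<noteq> q1 \<Longrightarrow> r dvd x"
    "reciprocal_character q1 (x\<^sup>2 + 1) = -1"
    using exists_square_plus_1_character[OF Q(1)[OF q1], of K] by blast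
  define N where "N = x\<^sup>2 + 1"
  have big: "p > K" if p: "prime p" "p dvd N" for p
  proof (rule ccontr)
    assume "\<not> p > K"
    moreover have nx: "\<not> p dvd x"
    proof
      assume "p dvd x"
      hence "p dvd x\<^sup>2" by (simp add: power2_eq_square)
      hence "p dvd N - x\<^sup>2" using p(2) by (intro dvd_diff_nat)
      hence "p dvd 1" by (simp add: N_def)
      thus False using p(1) by simp
    qed
    ultimately have "p = q1" using x(3)[OF p(1)] by linarith
    \<comment> \<open>Small primes other than \<open>q1\<close> divide \<open>x\<close>. So does 2,
      and an odd \<open>q1\<close> cannot divide \<open>N\<close> because its symbol is -1 instead
      of 0.\<close>
    have "p \<noteq> 2" using nx x(1) by auto
    hence "Legendre (int N) (int p) = -1" using x(4) \<open>p = q1\<close> by (simp add: reciprocal_character_def N_def)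
    hence "\<not> int p dvd int N" using Legendre_eq_0_iff[of "int N" "int p"] by simp
    thus False using p(2) by simp
  qed
  have "reciprocal_character q N = 1" if q: "q \<in> Q - {q1}" for q
  proof -
    have qx: "q dvd x" using x(3) Q q by auto
    show ?thesis
    proof (cases "q = 2")
      case True
      hence "4 dvd x" using x(2) q by auto
      then obtain j where "x = 4 * j" by (rule dvdE)
      hence "N = 8 * (2 * j\<^sup>2) + 1" by (simp add: N_def power2_eq_square)
      hence "N mod 8 = 1" by (simp only: mod_mult_self4) simp
      thus ?thesis using True by (simp add: reciprocal_character_def)
    next
      case False
      have "q dvd x\<^sup>2" using qx by (simp add: power2_eq_square)
      hence "[int N = 1] (mod int q)" by (simp add: N_def cong_iff_dvd_diff flip: of_nat_power)
      thus ?thesis using False Q(1)[of q] q Legendre_cong prime_gt_1_nat[of q]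
        by (simp add: reciprocal_character_def Legendre_1)
    qed
  qed
  hence prodN: "(\<Prod>q\<in>Q. reciprocal_character q N) = -1"
    using x(4) prod.remove[OF \<open>finite Q\<close> q1, of "\<lambda>q. reciprocal_character q N"] by (simp add: N_def)
  have mod4: "p mod 4 = 1" if "prime p" "p dvd N" for p
    using prime_dvd_square_plus_1[of p x] that big[OF that] by (simp add: N_def K_def)
  obtain p where p: "prime p" "p dvd N" "(\<Prod>q\<in>Q. reciprocal_character q p) \<noteq> 1"
    by (rule exists_prime_divisor_reciprocal_neq_1[of N Q]) (use Q(1) mod4 prodN in \<open>auto simp: N_def\<close>)
  have "p > K" by (rule big[OF p(1,2)])
  have nd: "\<not> p dvd D" using \<open>p > K\<close> assms(1) by (auto simp: K_def dest: dvd_imp_le)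
  hence "Legendre (int D) (int p) \<noteq> 1"
    using Legendre_eq_prod_reciprocal[OF p(1) mod4[OF p(1,2)] assms(1) nd] p(3) by (simp add: Q_def)
  moreover have "Legendre (int D) (int p) \<noteq> 0" using nd by (simp add: Legendre_eq_0_iff)
  ultimately have "Legendre (int D) (int p) = -1" using Legendre_cases by blast
  thus "\<exists>p>K0. p \<in> {p. prime p \<and> p > 2 \<and> Legendre (int D) (int p) = -1}"
    using p(1) \<open>p > K\<close> by (auto simp: K_def)
qed

section \<open>Counting sign patterns\<close>

text \<open>The indicator of the pattern is the product of the factors
  \<open>(1 + \<epsilon> \<chi>) / 2\<close>. In the expansion over subsets of \<open>Q\<close>, the
  empty set yields \<open>N\<close> and every other set an incomplete sum.\<close>

lemma count_sign_pattern:
  fixes u v :: "'i \<Rightarrow> int" and \<epsilon> :: int and e :: real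
  assumes Q: "finite Q" and \<epsilon>: "\<epsilon> \<in> {-1, 1}"
    and u: "\<And>q. q \<in> Q \<Longrightarrow> u q > 0"
    and uv: "\<And>q q'. q \<in> Q \<Longrightarrow> q' \<in> Q \<Longrightarrow> q \<noteq> q' \<Longrightarrow> u q * v q' \<noteq> u q' * v q"
    and e: "e > 0"
  shows "\<forall>\<^sub>F p in at_top. prime p \<longrightarrow> (\<forall>N<p.
    (\<forall>q\<in>Q. \<forall>n\<in>{1..N}. \<not> int p dvd u q * int n + v q) \<longrightarrow>
    \<bar>2 ^ card Q * real (card {n \<in> {1..N}. \<forall>q\<in>Q. Legendre (u q * int n + v q) (int p) = \<epsilon>}) - real N\<bar>
      \<le> e * real p)"
proof -
  \<comment> \<open>Each of the at most \<open>2 ^ card Q\<close> subsets contributes up to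
    \<open>2 e' p\<close>.\<close>
  define e' where "e' = e / 2 ^ (card Q + 1)"
  have e': "e' > 0" using e by (simp add: e'_def)
  have "\<forall>\<^sub>F p in at_top. \<forall>X\<in>Pow Q - {{}}. prime p \<longrightarrow> (\<forall>N\<le>p.
    \<bar>real_of_int (\<Sum>n<N. Legendre (\<Prod>q\<in>X. u q * int n + v q) (int p))\<bar> \<le> e' * real p)"
  proof (intro eventually_ball_finite ballI)
    fix X assume "X \<in> Pow Q - {{}}"
    hence X: "finite X" "X \<noteq> {}" "X \<subseteq> Q" using Q finite_subset by auto
    show "\<forall>\<^sub>F p in at_top. prime p \<longrightarrow> (\<forall>N\<le>p.
      \<bar>real_of_int (\<Sum>n<N. Legendre (\<Prod>q\<in>X. u q * int n + v q) (int p))\<bar> \<le> e' * real p)"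
      by (rule legendre_incomplete_sum[OF X(1,2) _ _ e']) (use X(3) u uv in blast)+
  qed (use Q in simp)
  moreover obtain P :: nat where P: "P > 1 / e'" using reals_Archimedean2 by blast
  ultimately show ?thesis using eventually_ge_at_top[of P] eventually_gt_at_top[of 2]
  proof (eventually_elim, intro impI allI)
    fix p N
    assume inc: "\<forall>X\<in>Pow Q - {{}}. prime p \<longrightarrow> (\<forall>N\<le>p.
      \<bar>real_of_int (\<Sum>n<N. Legendre (\<Prod>q\<in>X. u q * int n + v q) (int p))\<bar> \<le> e' * real p)"
      and Pp: "P \<le> p" and p2: "2 < p" and p: "prime p" and N: "N < p"
      and nd: "\<forall>q\<in>Q. \<forall>n\<in>{1..N}. \<not> int p dvd u q * int n + v q"
    let ?L = "\<lambda>a. Legendre a (int p)"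
    let ?l = "\<lambda>q n. ?L (u q * int n + v q)"
    have le1: "\<bar>?L a\<bar> \<le> 1" for a using Legendre_cases[of a "int p"] by auto
    have "1 \<le> e' * P" using P e' by (simp add: field_simps)
    also have "\<dots> \<le> e' * p" using Pp e' by simp
    finally have one: "1 \<le> e' * p" .
    define W where "W X = (\<Sum>n\<in>{1..N}. ?L (\<Prod>q\<in>X. u q * int n + v q))" for X
    have W: "\<bar>real_of_int (W X)\<bar> \<le> 2 * e' * p" if "X \<in> Pow Q - {{}}" for X
    proof -
      \<comment> \<open>The incomplete sums start at 0 but the count starts at 1; the extra term is
        at most \<open>1 \<le> e' p\<close>.\<close>
      have "{..<Suc N} = insert 0 {1..N}" by auto
      hence "(\<Sum>n<Suc N. ?L (\<Prod>q\<in>X. u q * int n + v q)) = ?L (\<Prod>q\<in>X. v q) + W X"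
        by (simp add: W_def del: sum.lessThan_Suc)
      moreover have "\<bar>real_of_int (\<Sum>n<Suc N. ?L (\<Prod>q\<in>X. u q * int n + v q))\<bar> \<le> e' * p"
        using inc that p N by (meson Suc_leI)
      moreover have "\<bar>real_of_int (?L (\<Prod>q\<in>X. v q))\<bar> \<le> 1" using le1[of "\<Prod>q\<in>X. v q"] by linarith
      ultimately show ?thesis using one by (simp del: sum.lessThan_Suc)
    qed
    have ind: "2 ^ card Q * of_bool (\<forall>q\<in>Q. ?l q n = \<epsilon>) = (\<Prod>q\<in>Q. \<epsilon> * ?l q n + 1)"
      if n: "n \<in> {1..N}" for n
    proof -
      \<comment> \<open>By \<open>nd\<close> no symbol vanishes, so a factor is either 0 or
        2.\<close>
      have "\<epsilon> * ?l q n + 1 = (if ?l q n = \<epsilon> then 2 else 0)" if "q \<in> Q" for q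
        using nd n that Legendre_cases[of "u q * int n + v q" "int p"] \<epsilon> by (auto simp: Legendre_eq_0_iff)
      hence "(\<Prod>q\<in>Q. \<epsilon> * ?l q n + 1) = (\<Prod>q\<in>Q. if ?l q n = \<epsilon> then 2 else 0)"
        by (rule prod.cong[OF refl])
      also have "\<dots> = 2 ^ card Q * of_bool (\<forall>q\<in>Q. ?l q n = \<epsilon>)"
        using Q by (auto intro: prod.cong[THEN trans, OF refl _ prod_constant])
      finally show ?thesis by simp
    qed
    have "2 ^ card Q * int (card {n \<in> {1..N}. \<forall>q\<in>Q. ?l q n = \<epsilon>}) =
        (\<Sum>n\<in>{1..N}. 2 ^ card Q * of_bool (\<forall>q\<in>Q. ?l q n = \<epsilon>))"
      by (simp add: sum_distrib_left[symmetric] Int_def)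
    also have "\<dots> = (\<Sum>n\<in>{1..N}. \<Prod>q\<in>Q. \<epsilon> * ?l q n + 1)" by (rule sum.cong[OF refl ind])
    also have "\<dots> = (\<Sum>n\<in>{1..N}. \<Sum>X\<in>Pow Q. \<epsilon> ^ card X * ?L (\<Prod>q\<in>X. u q * int n + v q))"
      by (simp add: prod_add[OF Q] prod.distrib Legendre_prod[OF p p2])
    also have "\<dots> = (\<Sum>X\<in>Pow Q. \<epsilon> ^ card X * W X)"
      by (subst sum.swap) (simp add: W_def sum_distrib_left)
    also have "\<dots> = W {} + (\<Sum>X\<in>Pow Q - {{}}. \<epsilon> ^ card X * W X)"
      using Q by (subst sum.remove[of _ "{}"]) auto
    also have "W {} = int N" using p2 by (simp add: W_def Legendre_1)
    finally have total: "2 ^ card Q * int (card {n \<in> {1..N}. \<forall>q\<in>Q. ?l q n = \<epsilon>}) =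
        int N + (\<Sum>X\<in>Pow Q - {{}}. \<epsilon> ^ card X * W X)" .
    have "real_of_int (2 ^ card Q * int (card {n \<in> {1..N}. \<forall>q\<in>Q. ?l q n = \<epsilon>})) =
        real_of_int (int N + (\<Sum>X\<in>Pow Q - {{}}. \<epsilon> ^ card X * W X))"
      by (simp only: total)
    hence "2 ^ card Q * real (card {n \<in> {1..N}. \<forall>q\<in>Q. ?l q n = \<epsilon>}) - real N =
        real_of_int (\<Sum>X\<in>Pow Q - {{}}. \<epsilon> ^ card X * W X)"
      by simp
    also have "\<bar>\<dots>\<bar> \<le> (\<Sum>X\<in>Pow Q - {{}}. \<bar>real_of_int (W X)\<bar>)"
      unfolding of_int_sum by (rule order_trans[OF sum_abs])
         (use \<epsilon> in \<open>auto simp: abs_mult power_abs intro!: sum_mono\<close>)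
    also have "\<dots> \<le> (\<Sum>X\<in>Pow Q - {{}}. 2 * e' * p)" by (intro sum_mono W)
    also have "\<dots> \<le> (\<Sum>X\<in>Pow Q. 2 * e' * p)" using Q e' by (intro sum_mono2) auto
    also have "\<dots> = e * p" using Q by (simp add: card_Pow e'_def)
    finally show "\<bar>2 ^ card Q * real (card {n \<in> {1..N}. \<forall>q\<in>Q. ?l q n = \<epsilon>}) - real N\<bar> \<le> e * p" .
  qed
qed

section \<open>The points of the scaled sets\<close>

locale progressions =
  fixes k :: nat and b :: "nat \<Rightarrow> nat" and S :: "nat \<Rightarrow> nat set"
  assumes k: "k \<ge> 1" and b_pos: "\<And>i. i \<in> {1..k} \<Longrightarrow> b i > 0"
    and S: "\<And>i. i \<in> {1..k} \<Longrightarrow> finite (S i)" "\<And>i. i \<in> {1..k} \<Longrightarrow> S i \<noteq> {}"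
begin

text \<open>The set \<open>Q\<close> of the overview.\<close>

definition points :: "rat set" where
  "points = (\<Union>i\<in>{1..k}. scaled (b i) (S i))"

text \<open>For a point \<open>q\<close> this is the unique \<open>K\<close> with \<open>q\<close>
  in \<open>T(K)\<close>.\<close>

definition indices :: "rat \<Rightarrow> nat set" where
  "indices q = {i \<in> {1..k}. q \<in> scaled (b i) (S i)}"

text \<open>For allowable \<open>p\<close> this is equivalent to a positive signature; it is the
  form in which the count uses that condition.\<close>

definition coherent :: "nat \<Rightarrow> bool" where
  "coherent p \<longleftrightarrow> (\<forall>q\<in>points. \<forall>i\<in>indices q. \<forall>j\<in>indices q.
     Legendre (int (b i)) (int p) = Legendre (int (b j)) (int p))"

lemma finite_points: "finite points"
  using S by (auto simp: points_def scaled_def)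

lemma finite_indices: "finite (indices q)"
  by (simp add: indices_def)

lemma mem_points_iff: "q \<in> points \<longleftrightarrow> indices q \<noteq> {}"
  by (auto simp: points_def indices_def)

lemma card_indices_ge_1: "q \<in> points \<Longrightarrow> card (indices q) \<ge> 1"
  by (simp add: mem_points_iff finite_indices Suc_le_eq card_gt_0_iff)

text \<open>The sets \<open>T(K)\<close> are the fibres of \<open>indices\<close>, which turns sums
  over \<open>K_max\<close> into sums over points.\<close>

lemma mem_T_of_iff: "K \<subseteq> {1..k} \<Longrightarrow> q \<in> T_of k b S K \<longleftrightarrow> indices q = K"
  by (auto simp: T_of_def S_of_def indices_def)

lemma K_max_eq: "K_max k b S = indices ` points"
proof (intro equalityI subsetI)
  fix K assume "K \<in> K_max k b S"
  hence K: "K \<noteq> {}" "K \<subseteq> {1..k}" "T_of k b S K \<noteq> {}" by (auto simp: K_max_def K_family_def)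
  then obtain q where "indices q = K" using mem_T_of_iff by blast
  thus "K \<in> indices ` points" using K(1) mem_points_iff by blast
next
  fix K assume "K \<in> indices ` points"
  then obtain q where q: "K = indices q" "indices q \<noteq> {}" using mem_points_iff by blast
  moreover have "indices q \<subseteq> {1..k}" by (auto simp: indices_def)
  moreover have "q \<in> T_of k b S (indices q)" using calculation mem_T_of_iff by simp
  moreover have "T_of k b S (indices q) \<subseteq> S_of b S (indices q)" by (auto simp: T_of_def)
  ultimately show "K \<in> K_max k b S" by (auto simp: K_max_def K_family_def)
qed

lemma Lambda_eq: "Lambda k b S = (\<Union>q\<in>points. even_subsets (indices q))"
  by (simp add: Lambda_def K_max_eq)

lemma Lambda_subset: "I \<in> Lambda k b S \<Longrightarrow> I \<subseteq> {1..k}"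
  by (auto simp: Lambda_eq even_subsets_def indices_def)

lemma finite_Lambda: "finite (Lambda k b S)"
proof (rule finite_subset)
  show "Lambda k b S \<subseteq> Pow {1..k}" using Lambda_subset by blast
qed simp

lemma doubleton_in_Lambda:
  assumes "q \<in> points" "i \<in> indices q" "j \<in> indices q" "i \<noteq> j"
  shows "{i, j} \<in> Lambda k b S"
  using assms by (auto simp: Lambda_eq even_subsets_def intro!: bexI[of _ q])

lemma e_exp_eq: "e_exp k b S = (\<Sum>q\<in>points. int (card (indices q)) - 1)"
proof -
  have "(\<Sum>q\<in>points. int (card (indices q)) - 1) =
      (\<Sum>K\<in>indices ` points. \<Sum>q\<in>{q \<in> points. indices q = K}. int (card (indices q)) - 1)"
    by (rule sum.image_gen[OF finite_points])
  also have "\<dots> = (\<Sum>K\<in>indices ` points. int (card (T_of k b S K)) * (int (card K) - 1))"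
  proof (rule sum.cong[OF refl])
    fix K assume K: "K \<in> indices ` points"
    hence "K \<subseteq> {1..k}" "K \<noteq> {}" using mem_points_iff by (auto simp: indices_def)
    hence "{q \<in> points. indices q = K} = T_of k b S K"
      using mem_T_of_iff mem_points_iff by auto
    moreover have "(\<Sum>q\<in>{q \<in> points. indices q = K}. int (card (indices q)) - 1) =
        (\<Sum>q\<in>{q \<in> points. indices q = K}. int (card K) - 1)"
      by (rule sum.cong) auto
    ultimately show "(\<Sum>q\<in>{q \<in> points. indices q = K}. int (card (indices q)) - 1) =
        int (card (T_of k b S K)) * (int (card K) - 1)" by simp
  qed
  finally show ?thesis by (simp add: e_exp_def K_max_eq)
qed

text \<open>Double counting of the pairs of an index and a point of its scaled set; scaling by a
  positive number is injective.\<close>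

lemma alpha_eq: "alpha k S = (\<Sum>q\<in>points. card (indices q))"
proof -
  have "alpha k S = (\<Sum>i\<in>{1..k}. card {q \<in> points. q \<in> scaled (b i) (S i)})"
    unfolding alpha_def
  proof (rule sum.cong[OF refl])
    fix i assume i: "i \<in> {1..k}"
    have "{q \<in> points. q \<in> scaled (b i) (S i)} = scaled (b i) (S i)" using i by (auto simp: points_def)
    moreover have "card (scaled (b i) (S i)) = card (S i)"
      unfolding scaled_def using b_pos[OF i] by (intro card_image) (auto simp: inj_on_def)
    ultimately show "card (S i) = card {q \<in> points. q \<in> scaled (b i) (S i)}" by simp
  qed
  also have "\<dots> = (\<Sum>q\<in>points. card {i \<in> {1..k}. q \<in> scaled (b i) (S i)})"
    by (rule sum_multicount_gen) (use finite_points in auto)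
  finally show ?thesis by (simp add: indices_def)
qed

lemma alpha_minus_e_exp: "int (alpha k S) - e_exp k b S = int (card points)"
  by (simp add: alpha_eq e_exp_eq sum_subtractf)

text \<open>Two indices at one point would form a member of \<open>Lambda\<close>, so every point
  has a single index.\<close>

lemma alpha_eq_card_points:
  assumes "Lambda k b S = {}"
  shows "alpha k S = card points"
proof -
  have "card (indices q) = 1" if q: "q \<in> points" for q
  proof -
    obtain i where i: "i \<in> indices q" using q mem_points_iff by blast
    hence "indices q = {i}" using doubleton_in_Lambda[OF q i] assms by auto
    thus ?thesis by simp
  qed
  thus ?thesis by (simp add: alpha_eq)
qed

lemma e_exp_pos:
  assumes "Lambda k b S \<noteq> {}"
  shows "e_exp k b S > 0"
proof -
  obtain q I where q: "q \<in> points" and I: "I \<subseteq> indices q" "I \<noteq> {}" "even (card I)" "finite I"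
    using assms by (auto simp: Lambda_eq even_subsets_def)
  have "card I \<noteq> 0" "card I \<noteq> 1" using I by auto
  hence "card I \<ge> 2" by linarith
  also have "card I \<le> card (indices q)" by (rule card_mono[OF finite_indices I(1)])
  finally have "int (card (indices q)) - 1 > 0" by simp
  moreover have "int (card (indices q')) - 1 \<ge> 0" if "q' \<in> points" for q'
    using card_indices_ge_1[OF that] by simp
  ultimately show ?thesis
    unfolding e_exp_eq by (rule sum_pos2[OF finite_points q])
qed

lemma positive_signature_iff:
  "positive_signature k b S p \<longleftrightarrow> (\<forall>I\<in>Lambda k b S. Legendre (int (\<Prod>i\<in>I. b i)) (int p) = 1)"
  using finite_Lambda by (auto simp: positive_signature_def signature_def)

lemma allowable_iff: "allowable k b p \<longleftrightarrow> prime p \<and> p > 2 \<and> (\<forall>i\<in>{1..k}. \<not> p dvd b i)"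
proof -
  have "odd p \<longleftrightarrow> p > 2" if "prime p"
    using prime_odd_nat[OF that] prime_ge_2_nat[OF that] by (cases "p = 2") auto
  thus ?thesis by (auto simp: allowable_def odd_primes_def)
qed

text \<open>The two-element members of \<open>Lambda\<close> suffice: symbols with product 1 are
  equal.\<close>

lemma coherentI:
  assumes "allowable k b p" "positive_signature k b S p"
  shows "coherent p"
  unfolding coherent_def
proof (intro ballI)
  fix q i j assume q: "q \<in> points" "i \<in> indices q" "j \<in> indices q"
  have p: "prime p" "p > 2" using assms(1) by (auto simp: allowable_iff)
  show "Legendre (int (b i)) (int p) = Legendre (int (b j)) (int p)"
  proof (cases "i = j")
    case False
    have "Legendre (int (\<Prod>l\<in>{i, j}. b l)) (int p) = 1"
      using doubleton_in_Lambda[OF q False] assms(2) positive_signature_iff by blast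
    hence "Legendre (int (b i)) (int p) * Legendre (int (b j)) (int p) = 1"
      using False by (simp add: Legendre_mult[OF p])
    thus ?thesis
      using Legendre_cases[of "int (b i)" "int p"] Legendre_cases[of "int (b j)" "int p"] by auto
  qed simp
qed

text \<open>Within one point all symbols are the same sign, here raised to an even power.\<close>

lemma positive_signatureI:
  assumes "allowable k b p" "coherent p"
  shows "positive_signature k b S p"
  unfolding positive_signature_iff
proof
  fix I assume "I \<in> Lambda k b S"
  then obtain q where q: "q \<in> points" and I: "I \<subseteq> indices q" "I \<noteq> {}" "even (card I)"
    by (auto simp: Lambda_eq even_subsets_def)
  have p: "prime p" "p > 2" using assms(1) by (auto simp: allowable_iff)
  obtain i where i: "i \<in> I" using I(2) by blast
  have "i \<in> {1..k}" using i I(1) by (auto simp: indices_def)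
  hence nd: "\<not> int p dvd int (b i)" using assms(1) by (simp add: allowable_iff)
  have "Legendre (int (\<Prod>j\<in>I. b j)) (int p) = (\<Prod>j\<in>I. Legendre (int (b j)) (int p))"
    by (simp add: Legendre_prod[OF p])
  also have "\<dots> = (\<Prod>j\<in>I. Legendre (int (b i)) (int p))"
    by (rule prod.cong) (use q i I assms(2) in \<open>auto simp: coherent_def\<close>)
  also have "\<dots> = 1"
    using I(3) Legendre_sq[OF nd] by (auto simp: power_mult power2_eq_square elim!: evenE)
  finally show "Legendre (int (\<Prod>j\<in>I. b j)) (int p) = 1" .
qed

section \<open>Counting the admissible progressions\<close>

definition progression :: "nat \<Rightarrow> nat set" where
  "progression n = (\<Union>i\<in>{1..k}. (\<lambda>x. b i * n + x) ` S i)"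

lemma finite_progression: "finite (progression n)"
  using S(1) by (auto simp: progression_def)

lemma progression_nonempty: "progression n \<noteq> {}"
  using S(2)[of 1] k by (auto simp: progression_def)

text \<open>Lets values of \<open>n\<close> be counted instead of sets. If
  \<open>b i * n + x\<close> is the largest element of one union, then a larger \<open>n'\<close>
  yields an element \<open>b i * n' + x\<close> beyond it.\<close>

lemma inj_progression: "inj progression"
proof (rule linorder_injI)
  fix n n' :: nat assume "n < n'"
  show "progression n \<noteq> progression n'"
  proof
    assume eq: "progression n = progression n'"
    have "Max (progression n) \<in> progression n"
      using finite_progression progression_nonempty by (rule Max_in)
    then obtain i x where i: "i \<in> {1..k}" "x \<in> S i" "Max (progression n) = b i * n + x"
      by (auto simp: progression_def)
    have "b i * n' + x \<in> progression n" unfolding eq using i by (auto simp: progression_def)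
    hence "b i * n' + x \<le> b i * n + x" using finite_progression i(3) by (metis Max_ge)
    thus False using \<open>n < n'\<close> b_pos[OF i(1)] by simp
  qed
qed

lemma c_count_eq:
  "c_count \<epsilon> k b S p = card {n. n \<ge> 1 \<and> progression n \<subseteq> {1..p - 1} \<and>
     (\<forall>a\<in>progression n. Legendre (int a) (int p) = \<epsilon>)}" (is "_ = card ?N")
proof -
  have "{A \<in> AP k b S \<inter> Pow {1..p - 1}. \<forall>a\<in>A. Legendre (int a) (int p) = \<epsilon>} = progression ` ?N"
    by (auto simp: AP_def progression_def[abs_def])
  moreover have "inj_on progression ?N" using inj_progression by (rule inj_on_subset) simp
  ultimately show ?thesis by (simp add: c_count_def card_image)
qed

lemma mem_scaledD:
  assumes "q \<in> scaled (b i) (S i)" "i \<in> {1..k}"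
  obtains z where "z \<in> S i" "of_nat z = of_nat (b i) * q"
  using assms b_pos by (fastforce simp: scaled_def)

text \<open>Since \<open>b\<^sub>i n + z\<^sub>i = b\<^sub>i (n + q)\<close> and \<open>b\<^sub>j n + z\<^sub>j = b\<^sub>j (n + q)\<close> for a common point
  \<open>q = z\<^sub>i / b\<^sub>i = z\<^sub>j / b\<^sub>j\<close>.\<close>

lemma Legendre_common_point:
  assumes "prime p" "p > 2"
    and z: "of_nat z = of_nat (b i) * (q :: rat)" "of_nat z' = of_nat (b j) * q"
  shows "Legendre (int (b i)) (int p) * Legendre (int (b j * n + z')) (int p) =
    Legendre (int (b j)) (int p) * Legendre (int (b i * n + z)) (int p)"
proof -
  have "(of_nat (b i * z') :: rat) = of_nat (b j * z)" using z by simp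
  hence "b i * z' = b j * z" by (simp only: of_nat_eq_iff)
  hence "b i * (b j * n + z') = b j * (b i * n + z)" by (simp add: algebra_simps)
  hence "int (b i) * int (b j * n + z') = int (b j) * int (b i * n + z)" by (metis of_nat_mult)
  thus ?thesis by (metis Legendre_mult[OF assms(1,2)])
qed

text \<open>A single counted progression gives both members at a common point the same symbol. Read
  backwards, the count is 0 at primes with a non-positive signature.\<close>

lemma c_count_neq_0_imp_coherent:
  assumes p: "allowable k b p" and "c_count \<epsilon> k b S p \<noteq> 0" and \<epsilon>: "\<epsilon> \<in> {-1, 1}"
  shows "coherent p"
  unfolding coherent_def
proof (intro ballI)
  fix q i j assume q: "q \<in> points" "i \<in> indices q" "j \<in> indices q"
  obtain n where n: "\<forall>a\<in>progression n. Legendre (int a) (int p) = \<epsilon>"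
    using assms(2) unfolding c_count_eq by (metis (mono_tags, lifting) card.empty Collect_empty_eq)
  have ij: "i \<in> {1..k}" "j \<in> {1..k}" "q \<in> scaled (b i) (S i)" "q \<in> scaled (b j) (S j)"
    using q by (auto simp: indices_def)
  obtain z where z: "z \<in> S i" "of_nat z = of_nat (b i) * q" using mem_scaledD[OF ij(3,1)] .
  obtain z' where z': "z' \<in> S j" "of_nat z' = of_nat (b j) * q" using mem_scaledD[OF ij(4,2)] .
  have "b i * n + z \<in> progression n" "b j * n + z' \<in> progression n"
    using ij z z' by (auto simp: progression_def)
  hence "Legendre (int (b i * n + z)) (int p) = \<epsilon>" "Legendre (int (b j * n + z')) (int p) = \<epsilon>"
    using n by blast+
  moreover have "prime p" "p > 2" using p by (auto simp: allowable_iff)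
  ultimately show "Legendre (int (b i)) (int p) = Legendre (int (b j)) (int p)"
    using Legendre_common_point[of p z i q z' j n] z z' \<epsilon> by auto
qed

lemma b_le_bmax: "i \<in> {1..k} \<Longrightarrow> b i \<le> bmax k b"
  by (simp add: bmax_def)

lemma bmax_attained: obtains i where "i \<in> {1..k}" "b i = bmax k b"
proof -
  have "bmax k b \<in> b ` {1..k}" unfolding bmax_def using k by (intro Max_in) auto
  thus thesis using that by auto
qed

text \<open>One form \<open>u q * n + v q\<close> represents each point; coherence passes its symbol
  on to all members at that point. Up to \<open>N\<close> all members stay below
  \<open>p\<close>.\<close>

lemma c_count_bounds:
  fixes \<epsilon> :: int
  assumes p: "prime p" "p > 2" and co: "coherent p" and nd: "\<And>i. i \<in> {1..k} \<Longrightarrow> \<not> p dvd b i"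
    and M: "\<And>i z. i \<in> {1..k} \<Longrightarrow> z \<in> S i \<Longrightarrow> z \<le> M" "M < p"
    and uv: "\<And>q. q \<in> points \<Longrightarrow> \<exists>i\<in>indices q. u q = int (b i) \<and> of_int (v q) = of_nat (b i) * q \<and> v q \<ge> 0"
  defines "N \<equiv> (p - 1 - M) div bmax k b"
    and "good \<equiv> \<lambda>n. \<forall>q\<in>points. Legendre (u q * int n + v q) (int p) = \<epsilon>"
  shows "card {n \<in> {1..N}. good n} \<le> c_count \<epsilon> k b S p"
    and "c_count \<epsilon> k b S p \<le> card {n \<in> {1..N}. good n} + M + 1"
proof -
  define C where "C = {n. n \<ge> 1 \<and> progression n \<subseteq> {1..p - 1} \<and>
     (\<forall>a\<in>progression n. Legendre (int a) (int p) = \<epsilon>)}"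
  have c: "c_count \<epsilon> k b S p = card C" by (simp add: c_count_eq C_def)
  obtain i0 where i0: "i0 \<in> {1..k}" "b i0 = bmax k b" by (rule bmax_attained)
  have bm: "bmax k b > 0" using b_pos[OF i0(1)] i0(2) by simp
  obtain z0 where z0: "z0 \<in> S i0" using S(2)[OF i0(1)] by blast
  have good: "good n" if "\<forall>a\<in>progression n. Legendre (int a) (int p) = \<epsilon>" for n
    unfolding good_def
  proof
    fix q assume q: "q \<in> points"
    obtain i where i: "i \<in> indices q" "u q = int (b i)" "of_int (v q) = of_nat (b i) * q" "v q \<ge> 0"
      using uv[OF q] by blast
    hence i': "i \<in> {1..k}" "q \<in> scaled (b i) (S i)" by (auto simp: indices_def)
    obtain z where z: "z \<in> S i" "of_nat z = of_nat (b i) * q" using mem_scaledD[OF i'(2,1)] .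
    have "(of_int (v q) :: rat) = of_int (int z)" using i(3) z(2) by simp
    hence "v q = int z" by (simp only: of_int_eq_iff)
    moreover have "b i * n + z \<in> progression n" using i' z by (auto simp: progression_def)
    ultimately show "Legendre (u q * int n + v q) (int p) = \<epsilon>" using that i(2) by force
  qed
  \<comment> \<open>The member with coefficient \<open>bmax k b\<close> leaves the interval soon
    after \<open>N\<close>, so at most \<open>M + 1\<close> further values of \<open>n\<close> can
    occur.\<close>
  have upper: "n \<le> N + M + 1" if "n \<in> C" for n
  proof -
    have "bmax k b * n + z0 \<in> progression n" using i0 z0 by (auto simp: progression_def intro!: bexI[of _ i0])
    hence "bmax k b * n + z0 \<le> p - 1" using that by (auto simp: C_def)
    hence "bmax k b * n \<le> (p - 1 - M) + M" using M(2) by linarith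
    also have "p - 1 - M < bmax k b * (N + 1)"
      unfolding N_def using bm dividend_less_div_times[of "bmax k b" "p - 1 - M"] by (simp add: mult.commute)
    also have "M \<le> bmax k b * M" using bm by simp
    finally have "bmax k b * n < bmax k b * (N + 1 + M)" by (simp add: distrib_left)
    hence "n < N + 1 + M" using mult_less_cancel1 by blast
    thus ?thesis by simp
  qed
  have finC: "finite C" by (rule finite_subset[of _ "{..N + M + 1}"]) (use upper in auto)
  have "C \<subseteq> {n \<in> {1..N}. good n} \<union> {N + 1..N + M + 1}"
    using upper good by (auto simp: C_def)
  hence "card C \<le> card ({n \<in> {1..N}. good n} \<union> {N + 1..N + M + 1})" by (intro card_mono) auto
  also have "\<dots> \<le> card {n \<in> {1..N}. good n} + card {N + 1..N + M + 1}" by (rule card_Un_le)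
  finally show "c_count \<epsilon> k b S p \<le> card {n \<in> {1..N}. good n} + M + 1" by (simp add: c)
  have "{n \<in> {1..N}. good n} \<subseteq> C"
  proof
    fix n assume "n \<in> {n \<in> {1..N}. good n}"
    hence n: "1 \<le> n" "n \<le> N" "good n" by auto
    have "a \<in> {1..p - 1} \<and> Legendre (int a) (int p) = \<epsilon>" if a: "a \<in> progression n" for a
    proof -
      obtain j z where j: "j \<in> {1..k}" "z \<in> S j" "a = b j * n + z" using a by (auto simp: progression_def)
      have "b j * n \<le> bmax k b * N" using b_le_bmax[OF j(1)] n(2) by (rule mult_le_mono)
      also have "\<dots> \<le> p - 1 - M" by (simp add: N_def)
      finally have "a \<le> p - 1" using M(1)[OF j(1,2)] M(2) j(3) by linarith
      moreover have "b j * n > 0" using b_pos[OF j(1)] n(1) by simp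
      hence "a \<ge> 1" using j(3) by linarith
      moreover have "Legendre (int a) (int p) = \<epsilon>"
      proof -
        define q where "q = (of_nat z / of_nat (b j) :: rat)"
        have qj: "q \<in> scaled (b j) (S j)" "of_nat z = of_nat (b j) * q"
          using j b_pos[OF j(1)] by (auto simp: q_def scaled_def)
        hence q: "q \<in> points" "j \<in> indices q" using j(1) by (auto simp: points_def indices_def)
        obtain i where i: "i \<in> indices q" "u q = int (b i)" "of_int (v q) = of_nat (b i) * q" "v q \<ge> 0"
          using uv[OF q(1)] by blast
        obtain z' where z': "v q = int z'" using i(4) by (rule nonneg_int_cases)
        hence "of_nat z' = of_nat (b i) * q" using i(3) by simp
        hence "Legendre (int (b i)) (int p) * Legendre (int a) (int p) =
            Legendre (int (b j)) (int p) * Legendre (int (b i * n + z')) (int p)"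
          unfolding j(3) using qj(2) by (rule Legendre_common_point[OF p])
        moreover have "Legendre (int (b i * n + z')) (int p) = \<epsilon>"
          using n(3) q(1) i(2) z' by (auto simp: good_def)
        moreover have "Legendre (int (b i)) (int p) = Legendre (int (b j)) (int p)"
          using co q i(1) unfolding coherent_def by blast
        moreover have "Legendre (int (b j)) (int p) \<noteq> 0" using nd[OF j(1)] by (simp add: Legendre_eq_0_iff)
        ultimately show ?thesis by simp
      qed
      ultimately show ?thesis by simp
    qed
    thus "n \<in> C" using n(1) by (auto simp: C_def)
  qed
  thus "card {n \<in> {1..N}. good n} \<le> c_count \<epsilon> k b S p" unfolding c using finC by (intro card_mono)
qed

lemma c_count_estimate:
  fixes e :: real
  assumes \<epsilon>: "\<epsilon> \<in> {-1, 1}" and e: "e > 0"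
  shows "\<forall>\<^sub>F p in at_top. prime p \<longrightarrow> coherent p \<longrightarrow>
    \<bar>2 ^ card points * real (c_count \<epsilon> k b S p) - real p / real (bmax k b)\<bar> \<le> e * real p"
proof -
  define M where "M = Max (\<Union>i\<in>{1..k}. S i)"
  have M: "z \<le> M" if "i \<in> {1..k}" "z \<in> S i" for i z
    unfolding M_def using S(1) that by (intro Max_ge) auto
  have "\<exists>i z. i \<in> indices q \<and> of_nat z = of_nat (b i) * q" if "q \<in> points" for q
  proof -
    obtain i where i: "i \<in> indices q" using \<open>q \<in> points\<close> mem_points_iff by blast
    hence "q \<in> scaled (b i) (S i)" "i \<in> {1..k}" by (auto simp: indices_def)
    then obtain z where "of_nat z = of_nat (b i) * q" by (rule mem_scaledD)
    thus ?thesis using i by blast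
  qed
  then obtain rep z where rep: "\<And>q. q \<in> points \<Longrightarrow> rep q \<in> indices q"
      "\<And>q. q \<in> points \<Longrightarrow> of_nat (z q) = of_nat (b (rep q)) * q"
    by metis
  define u where "u q = int (b (rep q))" for q
  define v where "v q = int (z q)" for q
  have u: "u q > 0" if "q \<in> points" for q
    using rep(1)[OF that] b_pos by (auto simp: u_def indices_def)
  \<comment> \<open>The quotient \<open>v q / u q\<close> is \<open>q\<close> itself, so
    proportional forms belong to the same point.\<close>
  have distinct: "u q * v q' \<noteq> u q' * v q" if q: "q \<in> points" "q' \<in> points" "q \<noteq> q'" for q q'
  proof
    assume "u q * v q' = u q' * v q"
    hence "(of_int (u q * v q') :: rat) = of_int (u q' * v q)" by simp
    hence "(of_int (u q) * of_int (u q')) * q' = (of_int (u q) * of_int (u q')) * q"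
      using rep(2)[OF q(1)] rep(2)[OF q(2)] by (simp add: u_def v_def)
    thus False using u[OF q(1)] u[OF q(2)] q(3) by simp
  qed
  have uv: "\<exists>i\<in>indices q. u q = int (b i) \<and> of_int (v q) = of_nat (b i) * q \<and> v q \<ge> 0"
    if "q \<in> points" for q
    using rep[OF that] by (intro bexI[of _ "rep q"]) (auto simp: u_def v_def)
  define B where "B = bmax k b"
  obtain i0 where i0: "i0 \<in> {1..k}" "b i0 = B" unfolding B_def by (rule bmax_attained)
  have B: "B > 0" using b_pos[OF i0(1)] i0(2) by simp
  \<comment> \<open>Collects the boundary errors: up to \<open>M + 1\<close> additional values of
    \<open>n\<close>, weighted by the power of 2, and up to \<open>M + 2\<close> between
    \<open>N\<close> and \<open>p / B\<close>.\<close>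
  define c0 where "c0 = 2 ^ card points * (real M + 1) + real M + 2"
  obtain P :: nat where P: "P > 2 * c0 / e" using reals_Archimedean2 by blast
  have "\<forall>\<^sub>F p in at_top. prime p \<longrightarrow> (\<forall>N<p. (\<forall>q\<in>points. \<forall>n\<in>{1..N}. \<not> int p dvd u q * int n + v q) \<longrightarrow>
      \<bar>2 ^ card points * real (card {n \<in> {1..N}. \<forall>q\<in>points. Legendre (u q * int n + v q) (int p) = \<epsilon>}) - real N\<bar>
        \<le> e / 2 * real p)"
    by (intro count_sign_pattern finite_points \<epsilon> u distinct) (use e in simp_all)
  thus ?thesis
    using eventually_gt_at_top[of "M + B + 2"] eventually_ge_at_top[of P]
  proof (eventually_elim, intro impI)
    fix p
    assume pat: "prime p \<longrightarrow> (\<forall>N<p. (\<forall>q\<in>points. \<forall>n\<in>{1..N}. \<not> int p dvd u q * int n + v q) \<longrightarrow>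
        \<bar>2 ^ card points * real (card {n \<in> {1..N}. \<forall>q\<in>points. Legendre (u q * int n + v q) (int p) = \<epsilon>}) - real N\<bar>
          \<le> e / 2 * real p)"
      and big: "M + B + 2 < p" "P \<le> p" and p: "prime p" "coherent p"
    define N where "N = (p - 1 - M) div B"
    define G where "G = card {n \<in> {1..N}. \<forall>q\<in>points. Legendre (u q * int n + v q) (int p) = \<epsilon>}"
    define c where "c = c_count \<epsilon> k b S p"
    have ndb: "\<not> p dvd b i" if "i \<in> {1..k}" for i
      using b_le_bmax[OF that] b_pos[OF that] big(1) by (auto simp: B_def dest: dvd_imp_le)
    have "p > 2" "M < p" using big by auto
    have G: "G \<le> c" "c \<le> G + M + 1"
      using c_count_bounds[OF p(1) \<open>p > 2\<close> p(2) ndb M \<open>M < p\<close> uv, where \<epsilon> = \<epsilon>]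
      by (simp_all add: G_def N_def B_def c_def)
    have BN: "B * N \<le> p - 1 - M" by (simp add: N_def)
    have "N \<le> B * N" using B by simp
    hence "N < p" using BN big by linarith
    have nd: "\<not> int p dvd u q * int n + v q" if q: "q \<in> points" and n: "n \<in> {1..N}" for q n
    proof -
      have r: "rep q \<in> {1..k}" "q \<in> scaled (b (rep q)) (S (rep q))" using rep(1)[OF q] by (auto simp: indices_def)
      obtain z' where z': "z' \<in> S (rep q)" "of_nat z' = of_nat (b (rep q)) * q" using mem_scaledD[OF r(2,1)] .
      have "(of_nat z' :: rat) = of_nat (z q)" using z'(2) rep(2)[OF q] by simp
      hence "z q \<le> M" using M[OF r(1) z'(1)] by (simp only: of_nat_eq_iff)
      moreover have "b (rep q) * n \<le> B * N" using b_le_bmax[OF r(1)] n unfolding B_def by (intro mult_le_mono) auto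
      ultimately have "b (rep q) * n + z q < p" using BN big by linarith
      moreover have "b (rep q) * n + z q > 0" using b_pos[OF r(1)] n by simp
      ultimately have "\<not> p dvd b (rep q) * n + z q" by (simp add: nat_dvd_not_less)
      hence "\<not> int p dvd int (b (rep q) * n + z q)" by (simp only: of_nat_dvd_iff not_False_eq_True)
      thus ?thesis by (simp add: u_def v_def)
    qed
    have est: "\<bar>2 ^ card points * real G - real N\<bar> \<le> e / 2 * real p"
      unfolding G_def using pat p(1) \<open>N < p\<close> nd by blast
    have "p - 1 - M < B * (N + 1)"
      unfolding N_def using B dividend_less_div_times[of B "p - 1 - M"] by (simp add: mult.commute)
    hence "p \<le> B * (N + 1) + M + 1" using big by linarith
    also have "\<dots> \<le> B * (N + 1) + B * (M + 1)"
      using mult_le_mono1[of 1 B "M + 1"] B by simp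
    also have "\<dots> = B * (N + M + 2)" by (simp add: algebra_simps)
    finally have "real p \<le> real B * (real N + real M + 2)"
      by (metis of_nat_add of_nat_le_iff of_nat_mult of_nat_numeral)
    hence up: "real p / real B \<le> real N + real M + 2" using B by (simp add: field_simps)
    have "B * N \<le> p" using BN by linarith
    hence low: "real N \<le> real p / real B" using B by (simp add: field_simps flip: of_nat_mult)
    have "2 ^ card points * real G \<le> 2 ^ card points * real c" using G(1) by simp
    moreover have "2 ^ card points * real c \<le> 2 ^ card points * (real G + (real M + 1))"
      using G(2) by (intro mult_left_mono) auto
    hence "2 ^ card points * real c \<le> 2 ^ card points * real G + 2 ^ card points * (real M + 1)"
      by (simp add: distrib_left)
    moreover have "2 ^ card points * (real M + 1) \<ge> 0" by simp
    ultimately have "\<bar>2 ^ card points * real c - real p / real B\<bar> \<le> e / 2 * real p + c0"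
      using est up low unfolding c0_def by linarith
    also have "c0 \<le> e / 2 * real P" using P e by (simp add: field_simps)
    also have "\<dots> \<le> e / 2 * real p" using big(2) e by simp
    finally show "\<bar>2 ^ card points * real (c_count \<epsilon> k b S p) - real p / real (bmax k b)\<bar> \<le> e * real p"
      by (simp add: c_def B_def)
  qed
qed

lemma sim_inside_c_count:
  assumes \<epsilon>: "\<epsilon> \<in> {-1, 1}" and P: "\<And>p. p \<in> P \<Longrightarrow> prime p"
    and co: "\<forall>\<^sub>F p in at_top. p \<in> P \<longrightarrow> coherent p"
  shows "sim_inside P (\<lambda>p. real (c_count \<epsilon> k b S p))
    (\<lambda>p. inverse (real (bmax k b) * 2 ^ card points) * real p)"
  unfolding sim_inside_def
proof (rule asymp_equivI', rule tendstoI)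
  fix e :: real assume e: "e > 0"
  obtain i0 where i0: "i0 \<in> {1..k}" "b i0 = bmax k b" by (rule bmax_attained)
  have B: "bmax k b > 0" using b_pos[OF i0(1)] i0(2) by simp
  define e' where "e' = e / (2 * real (bmax k b))"
  have "e' > 0" using e B by (simp add: e'_def)
  show "\<forall>\<^sub>F p in inf at_top (principal P). dist (real (c_count \<epsilon> k b S p) /
      (inverse (real (bmax k b) * 2 ^ card points) * real p)) 1 < e"
    unfolding eventually_inf_principal
    using co c_count_estimate[OF \<epsilon> \<open>e' > 0\<close>]
  proof (eventually_elim, intro impI)
    fix p assume "p \<in> P \<longrightarrow> coherent p" and est: "prime p \<longrightarrow> coherent p \<longrightarrow>
      \<bar>2 ^ card points * real (c_count \<epsilon> k b S p) - real p / real (bmax k b)\<bar> \<le> e' * real p"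
      and "p \<in> P"
    hence p: "prime p" "coherent p" using P by auto
    define x where "x = 2 ^ card points * real (c_count \<epsilon> k b S p)"
    have p0: "real p > 0" using p(1) prime_gt_0_nat by simp
    have "real (c_count \<epsilon> k b S p) / (inverse (real (bmax k b) * 2 ^ card points) * real p) - 1 =
        (x - real p / real (bmax k b)) * (real (bmax k b) / real p)"
      using p0 B by (simp add: x_def field_simps)
    also have "\<bar>\<dots>\<bar> = \<bar>x - real p / real (bmax k b)\<bar> * (real (bmax k b) / real p)"
      using p0 by (simp add: abs_mult)
    also have "\<dots> \<le> (e' * real p) * (real (bmax k b) / real p)"
      using est p p0 by (intro mult_right_mono) (auto simp: x_def)
    also have "\<dots> = e / 2" using p0 B by (simp add: e'_def)
    also have "\<dots> < e" using e by simp
    finally show "dist (real (c_count \<epsilon> k b S p) /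
      (inverse (real (bmax k b) * 2 ^ card points) * real p)) 1 < e" by (simp add: dist_real_def)
  qed
qed

section \<open>The two sets of primes\<close>

lemma eventually_allowable: "\<forall>\<^sub>F p in at_top. p \<in> odd_primes \<longrightarrow> allowable k b p"
  using eventually_gt_at_top[of "bmax k b"]
proof eventually_elim
  case (elim p)
  thus ?case using b_le_bmax b_pos by (fastforce simp: allowable_def dest: dvd_imp_le)
qed

lemma infinite_Pi_plus: "infinite (Pi_plus k b S)"
proof (rule infinite_super)
  define m where "m = (\<Prod>i\<in>{1..k}. b i)"
  show "infinite {p. prime p \<and> p > 2 \<and> (\<forall>D. D dvd m \<longrightarrow> Legendre (int D) (int p) = 1)}"
    by (rule infinite_primes_all_residues) (use b_pos in \<open>auto simp: m_def intro!: prod_pos\<close>)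
  show "{p. prime p \<and> p > 2 \<and> (\<forall>D. D dvd m \<longrightarrow> Legendre (int D) (int p) = 1)} \<subseteq> Pi_plus k b S"
  proof clarify
    fix p assume p: "prime p" "p > 2" and L: "\<forall>D. D dvd m \<longrightarrow> Legendre (int D) (int p) = 1"
    have "Legendre (int (b i)) (int p) = 1" if "i \<in> {1..k}" for i
    proof -
      have "b i dvd m" unfolding m_def by (rule dvd_prodI) (use that in auto)
      thus ?thesis using L by blast
    qed
    hence "\<not> p dvd b i" if "i \<in> {1..k}" for i
      using that Legendre_eq_0_iff[of "int (b i)" "int p"] by auto
    moreover have "Legendre (int (\<Prod>i\<in>I. b i)) (int p) = 1" if "I \<in> Lambda k b S" for I
      using L prod_dvd_prod_subset[OF _ Lambda_subset[OF that], of b] unfolding m_def by blast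
    ultimately show "p \<in> Pi_plus k b S"
      using p by (simp add: Pi_plus_def allowable_iff positive_signature_iff)
  qed
qed

lemma infinite_Pi_minus:
  assumes "I \<in> Lambda k b S" "\<not> is_square (\<Prod>i\<in>I. b i)"
  shows "infinite (Pi_minus k b S)"
proof (rule infinite_super)
  define D where "D = (\<Prod>i\<in>I. b i)"
  have "D > 0" using Lambda_subset[OF assms(1)] b_pos by (auto simp: D_def intro!: prod_pos)
  hence "infinite {p. prime p \<and> p > 2 \<and> Legendre (int D) (int p) = -1}"
    using assms(2) by (intro infinite_primes_nonresidue) (simp_all add: D_def)
  \<comment> \<open>Discarding the primes up to \<open>bmax k b\<close> leaves only allowable
    ones.\<close>
  thus "infinite ({p. prime p \<and> p > 2 \<and> Legendre (int D) (int p) = -1} - {..bmax k b})"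
    by (rule Diff_infinite_finite[rotated]) simp
  show "{p. prime p \<and> p > 2 \<and> Legendre (int D) (int p) = -1} - {..bmax k b} \<subseteq> Pi_minus k b S"
  proof
    fix p assume "p \<in> {p. prime p \<and> p > 2 \<and> Legendre (int D) (int p) = -1} - {..bmax k b}"
    hence p: "prime p" "p > 2" "Legendre (int D) (int p) = -1" "p > bmax k b" by auto
    have "\<not> p dvd b i" if "i \<in> {1..k}" for i
      using b_le_bmax[OF that] b_pos[OF that] p(4) by (auto dest: dvd_imp_le)
    moreover have "\<not> positive_signature k b S p"
      using p(3) assms(1) unfolding positive_signature_iff D_def by force
    ultimately show "p \<in> Pi_minus k b S" using p by (simp add: Pi_minus_def allowable_iff)
  qed
qed

lemma positive_signature_if_squares:
  assumes "\<forall>I\<in>Lambda k b S. is_square (\<Prod>i\<in>I. b i)" "allowable k b p"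
  shows "positive_signature k b S p"
  unfolding positive_signature_iff
proof
  fix I assume I: "I \<in> Lambda k b S"
  have p: "prime p" "p > 2" using assms(2) by (auto simp: allowable_iff)
  obtain y where y: "(\<Prod>i\<in>I. b i) = y\<^sup>2" using assms(1) I by (auto simp: is_nth_power_def)
  have "finite I" using Lambda_subset[OF I] finite_subset by blast
  hence "\<not> p dvd (\<Prod>i\<in>I. b i)"
    using assms(2) Lambda_subset[OF I] by (auto simp: prime_dvd_prod_iff[OF _ p(1)] allowable_iff)
  hence "\<not> p dvd y" unfolding y by (auto simp: power2_eq_square)
  hence "\<not> int p dvd int y" by simp
  thus "Legendre (int (\<Prod>i\<in>I. b i)) (int p) = 1"
    unfolding y by (simp add: power2_eq_square Legendre_mult[OF p] Legendre_sq)
qed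

end

theorem theorem6p1:
  fixes \<epsilon> :: int and k :: nat and b :: "nat \<Rightarrow> nat" and S :: "nat \<Rightarrow> nat set"
  assumes "\<epsilon> \<in> {-1, 1}"
    and "k \<ge> 1"
    and "inj_on b {1..k}"
    and "\<forall>i\<in>{1..k}. b i > 0"
    and "\<forall>i\<in>{1..k}. finite (S i) \<and> S i \<noteq> {}"
  shows
    "(Lambda k b S = {} \<longrightarrow>
        sim_inside odd_primes (\<lambda>p. real (c_count \<epsilon> k b S p))
          (\<lambda>p. inverse (real (bmax k b) * 2 ^ alpha k S) * real p)) \<and>
     (Lambda k b S \<noteq> {} \<longrightarrow>
        e_exp k b S > 0 \<and>
        ((\<forall>I\<in>Lambda k b S. is_square (\<Prod>i\<in>I. b i)) \<longrightarrow>
           sim_inside odd_primes (\<lambda>p. real (c_count \<epsilon> k b S p))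
             (\<lambda>p. inverse (real (bmax k b) * 2 powi (int (alpha k S) - e_exp k b S)) * real p)) \<and>
        ((\<exists>I\<in>Lambda k b S. \<not> is_square (\<Prod>i\<in>I. b i)) \<longrightarrow>
           infinite (Pi_plus k b S) \<and> infinite (Pi_minus k b S) \<and>
           (\<forall>p\<in>Pi_minus k b S. c_count \<epsilon> k b S p = 0) \<and>
           sim_inside (Pi_plus k b S) (\<lambda>p. real (c_count \<epsilon> k b S p))
             (\<lambda>p. inverse (real (bmax k b) * 2 powi (int (alpha k S) - e_exp k b S)) * real p)))"
proof -
  interpret progressions k b S
    by unfold_locales (use assms in auto)
  \<comment> \<open>The exponent is the number of points, so the integer power is an ordinary
    one.\<close>
  have pow: "(2::real) powi (int (alpha k S) - e_exp k b S) = 2 ^ card points"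
    by (simp add: alpha_minus_e_exp)
  \<comment> \<open>This also covers an empty \<open>Lambda\<close>, where the condition holds
    vacuously and \<open>alpha\<close> is the number of points.\<close>
  have squares: "sim_inside odd_primes (\<lambda>p. real (c_count \<epsilon> k b S p))
      (\<lambda>p. inverse (real (bmax k b) * 2 ^ card points) * real p)"
    if "\<forall>I\<in>Lambda k b S. is_square (\<Prod>i\<in>I. b i)"
  proof (rule sim_inside_c_count[OF assms(1)])
    show "\<forall>\<^sub>F p in at_top. p \<in> odd_primes \<longrightarrow> coherent p"
      using eventually_allowable
      by eventually_elim (use that coherentI positive_signature_if_squares in blast)
  qed (simp add: odd_primes_def)
  have Pi_plus: "sim_inside (Pi_plus k b S) (\<lambda>p. real (c_count \<epsilon> k b S p))
      (\<lambda>p. inverse (real (bmax k b) * 2 ^ card points) * real p)"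
    by (rule sim_inside_c_count[OF assms(1)])
      (auto simp: Pi_plus_def allowable_iff intro!: always_eventually coherentI)
  have Pi_minus: "\<forall>p\<in>Pi_minus k b S. c_count \<epsilon> k b S p = 0"
    using c_count_neq_0_imp_coherent[OF _ _ assms(1)] positive_signatureI by (auto simp: Pi_minus_def)
  show ?thesis
    unfolding pow using squares Pi_plus Pi_minus infinite_Pi_plus infinite_Pi_minus e_exp_pos
      alpha_eq_card_points by auto
qed

end
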